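(* Let $\mathcal{A}$ be an abelian category and let $\Delta:Pr(\mathcal{A})\to Pr(\mathcal{A}^{op})$ be the duality assignment $\Delta(\tau)=(\tau^* )^{op}$. For any $\tau,\sigma\in Pr(\mathcal{A})$: (a) $\Delta\big((\sigma:\tau)\big)=\Delta(\tau)\cdot\Delta(\sigma)$; (b) $\Delta(\tau\cdot\sigma)=(\Delta(\sigma):\Delta(\tau))$.
   Context: A preradical of an abelian category $\mathcal{A}$ is a subobject of the identity functor $1_{\mathcal{A}}$ in the (possibly extended) abelian category $\mathrm{Fun}(\mathcal{A},\mathcal{A})$, i.e. the equivalence class of a monomorphic natural transformation $\tau:T\hookrightarrow 1_{\mathcal{A}}$, two such being equivalent if each factors through the other. $Pr(\mathcal{A})$ is the collection of preradicals of $\mathcal{A}$. For $\tau:T\hookrightarrow1_{\mathcal{A}}$, $\tau^*:1_{\mathcal{A}}\twoheadrightarrow T^*$ denotes its cokernel. For a functor $T:\mathcal{A}\to\mathcal{A}$, $T^{op}:\mathcal{A}^{op}\to\mathcal{A}^{op}$ is given by $T^{op}(A)=T(A)$, $T^{op}(f^{op})=T(f)^{op}$; thus $(\tau^* )^{op}:(T^* )^{op}\to 1_{\mathcal{A}^{op}}$ is a preradical of $\mathcal{A}^{op}$. For $\tau:T\hookrightarrow 1_{\mathcal{A}}$ and $\sigma:S\hookrightarrow 1_{\mathcal{A}}$, the product $\tau\cdot\sigma$ is the class of $\sigma\circ\tau S=\tau\circ T\sigma:TS\to 1_{\mathcal{A}}$ (where $(\tau S)_A=\tau_{S(A)}$,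 $(T\sigma)_A=T(\sigma_A)$). The coproduct $(\sigma:\tau)$ is the preradical represented by the pullback of $\tau S^*:TS^*\hookrightarrow S^*$ along $\sigma^*:1_{\mathcal{A}}\to S^*$. The same definitions are used for $\mathcal{A}^{op}$. *)

theory Defs
  imports "HOL-Algebra.Group" "HOL-Library.FuncSet"
begin

section \<open>Categories\<close>

record ('o, 'a) cat =
  Obj :: "'o set"
  Arr :: "'a set"
  Dom :: "'a \<Rightarrow> 'o"
  Cod :: "'a \<Rightarrow> 'o"
  Ide :: "'o \<Rightarrow> 'a"
  Comp :: "'a \<Rightarrow> 'a \<Rightarrow> 'a" (infixl "\<cdot>\<index>" 70)

definition Hom :: "('o, 'a) cat \<Rightarrow> 'o \<Rightarrow> 'o \<Rightarrow> 'a set" where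
  "Hom C A B = {f \<in> Arr C. Dom C f = A \<and> Cod C f = B}"

locale category =
  fixes C :: "('o, 'a) cat" (structure)
  assumes dom_obj: "f \<in> Arr C \<Longrightarrow> Dom C f \<in> Obj C"
    and cod_obj: "f \<in> Arr C \<Longrightarrow> Cod C f \<in> Obj C"
    and ide_hom: "A \<in> Obj C \<Longrightarrow> Ide C A \<in> Hom C A A"
    and comp_hom: "f \<in> Hom C A B \<Longrightarrow> g \<in> Hom C B D \<Longrightarrow> g \<cdot> f \<in> Hom C A D"
    and comp_ide_right: "f \<in> Arr C \<Longrightarrow> f \<cdot> Ide C (Dom C f) = f"
    and comp_ide_left: "f \<in> Arr C \<Longrightarrow> Ide C (Cod C f) \<cdot> f = f"
    and comp_assoc: "f \<in> Hom C A B \<Longrightarrow> g \<in> Hom C B D \<Longrightarrow> h \<in> Hom C D E \<Longrightarrow>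
      h \<cdot> (g \<cdot> f) = (h \<cdot> g) \<cdot> f"

text \<open>The opposite category has the same objects and the same arrows as elements, so the
  passage from an arrow f to its opposite is the identity on data.\<close>

definition op_cat :: "('o, 'a) cat \<Rightarrow> ('o, 'a) cat" where
  "op_cat C = \<lparr>Obj = Obj C, Arr = Arr C, Dom = Cod C, Cod = Dom C, Ide = Ide C,
     Comp = (\<lambda>g f. f \<cdot>\<^bsub>C\<^esub> g)\<rparr>"

definition is_mono :: "('o, 'a) cat \<Rightarrow> 'a \<Rightarrow> bool" where
  "is_mono C m \<longleftrightarrow> m \<in> Arr C \<and>
     (\<forall>g\<in>Arr C. \<forall>h\<in>Arr C. Cod C g = Dom C m \<and> Cod C h = Dom C m \<and> Dom C g = Dom C h \<and>
        m \<cdot>\<^bsub>C\<^esub> g = m \<cdot>\<^bsub>C\<^esub> h \<longrightarrow> g = h)"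

definition is_epi :: "('o, 'a) cat \<Rightarrow> 'a \<Rightarrow> bool" where
  "is_epi C e \<longleftrightarrow> is_mono (op_cat C) e"

definition is_terminal :: "('o, 'a) cat \<Rightarrow> 'o \<Rightarrow> bool" where
  "is_terminal C Z \<longleftrightarrow> Z \<in> Obj C \<and> (\<forall>A\<in>Obj C. \<exists>!f. f \<in> Hom C A Z)"

definition is_zero_obj :: "('o, 'a) cat \<Rightarrow> 'o \<Rightarrow> bool" where
  "is_zero_obj C Z \<longleftrightarrow> is_terminal C Z \<and> is_terminal (op_cat C) Z"

definition is_zero_arr :: "('o, 'a) cat \<Rightarrow> 'a \<Rightarrow> bool" where
  "is_zero_arr C f \<longleftrightarrow> f \<in> Arr C \<and>
     (\<exists>Z. is_zero_obj C Z \<and>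
       (\<exists>g\<in>Hom C (Dom C f) Z. \<exists>h\<in>Hom C Z (Cod C f). f = h \<cdot>\<^bsub>C\<^esub> g))"

definition is_kernel :: "('o, 'a) cat \<Rightarrow> 'a \<Rightarrow> 'a \<Rightarrow> bool" where
  "is_kernel C k f \<longleftrightarrow> f \<in> Arr C \<and> k \<in> Arr C \<and> Cod C k = Dom C f \<and>
     is_zero_arr C (f \<cdot>\<^bsub>C\<^esub> k) \<and>
     (\<forall>h\<in>Arr C. Cod C h = Dom C f \<and> is_zero_arr C (f \<cdot>\<^bsub>C\<^esub> h) \<longrightarrow>
        (\<exists>!u. u \<in> Hom C (Dom C h) (Dom C k) \<and> k \<cdot>\<^bsub>C\<^esub> u = h))"

definition is_cokernel :: "('o, 'a) cat \<Rightarrow> 'a \<Rightarrow> 'a \<Rightarrow> bool" where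
  "is_cokernel C q f \<longleftrightarrow> is_kernel (op_cat C) q f"

definition is_product :: "('o, 'a) cat \<Rightarrow> 'o \<Rightarrow> 'o \<Rightarrow> 'o \<Rightarrow> 'a \<Rightarrow> 'a \<Rightarrow> bool" where
  "is_product C A B P p q \<longleftrightarrow> P \<in> Obj C \<and> p \<in> Hom C P A \<and> q \<in> Hom C P B \<and>
     (\<forall>X\<in>Obj C. \<forall>a\<in>Hom C X A. \<forall>b\<in>Hom C X B.
        \<exists>!u. u \<in> Hom C X P \<and> p \<cdot>\<^bsub>C\<^esub> u = a \<and> q \<cdot>\<^bsub>C\<^esub> u = b)"

text \<open>p and q are the projections of a pullback of f along g: the square
  f p = g q commutes and is universal.\<close>

definition is_pullback :: "('o, 'a) cat \<Rightarrow> 'a \<Rightarrow> 'a \<Rightarrow> 'a \<Rightarrow> 'a \<Rightarrow> bool" where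
  "is_pullback C f g p q \<longleftrightarrow>
     f \<in> Arr C \<and> g \<in> Arr C \<and> p \<in> Arr C \<and> q \<in> Arr C \<and>
     Cod C f = Cod C g \<and> Dom C p = Dom C q \<and> Cod C p = Dom C f \<and> Cod C q = Dom C g \<and>
     f \<cdot>\<^bsub>C\<^esub> p = g \<cdot>\<^bsub>C\<^esub> q \<and>
     (\<forall>X\<in>Obj C. \<forall>a\<in>Hom C X (Dom C f). \<forall>b\<in>Hom C X (Dom C g). f \<cdot>\<^bsub>C\<^esub> a = g \<cdot>\<^bsub>C\<^esub> b \<longrightarrow>
        (\<exists>!u. u \<in> Hom C X (Dom C p) \<and> p \<cdot>\<^bsub>C\<^esub> u = a \<and> q \<cdot>\<^bsub>C\<^esub> u = b))"


section \<open>Abelian categories\<close>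

definition is_Ab_enrichment :: "('o, 'a) cat \<Rightarrow> ('a \<Rightarrow> 'a \<Rightarrow> 'a) \<Rightarrow> ('o \<Rightarrow> 'o \<Rightarrow> 'a) \<Rightarrow> bool" where
  "is_Ab_enrichment C add zer \<longleftrightarrow>
     (\<forall>A\<in>Obj C. \<forall>B\<in>Obj C.
        comm_group \<lparr>carrier = Hom C A B, monoid.mult = add, one = zer A B\<rparr>) \<and>
     (\<forall>A\<in>Obj C. \<forall>B\<in>Obj C. \<forall>D\<in>Obj C.
        (\<forall>f\<in>Hom C A B. \<forall>g\<in>Hom C A B. \<forall>h\<in>Hom C B D.
           h \<cdot>\<^bsub>C\<^esub> add f g = add (h \<cdot>\<^bsub>C\<^esub> f) (h \<cdot>\<^bsub>C\<^esub> g)) \<and>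
        (\<forall>f\<in>Hom C A B. \<forall>g\<in>Hom C B D. \<forall>h\<in>Hom C B D.
           add g h \<cdot>\<^bsub>C\<^esub> f = add (g \<cdot>\<^bsub>C\<^esub> f) (h \<cdot>\<^bsub>C\<^esub> f)))"

locale abelian_category = category +
  assumes ab_enriched: "\<exists>add zer. is_Ab_enrichment C add zer"
    and has_zero: "\<exists>Z. is_zero_obj C Z"
    and has_products: "A \<in> Obj C \<Longrightarrow> B \<in> Obj C \<Longrightarrow> \<exists>P p q. is_product C A B P p q"
    and has_coproducts: "A \<in> Obj C \<Longrightarrow> B \<in> Obj C \<Longrightarrow> \<exists>P p q. is_product (op_cat C) A B P p q"
    and has_kernels: "f \<in> Arr C \<Longrightarrow> \<exists>k. is_kernel C k f"
    and has_cokernels: "f \<in> Arr C \<Longrightarrow> \<exists>q. is_cokernel C q f"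
    and mono_normal: "is_mono C m \<Longrightarrow> \<exists>f. is_kernel C m f"
    and epi_normal: "is_epi C e \<Longrightarrow> \<exists>f. is_cokernel C e f"


section \<open>Functors and natural transformations\<close>

text \<open>Functors and natural transformations are required to be extensional outside the objects
  and arrows of the source category, so that HOL equality is the intended equality.\<close>

record ('o, 'a, 'p, 'b) funct =
  FO :: "'o \<Rightarrow> 'p"
  FA :: "'a \<Rightarrow> 'b"

definition is_funct :: "('o, 'a) cat \<Rightarrow> ('p, 'b) cat \<Rightarrow> ('o, 'a, 'p, 'b) funct \<Rightarrow> bool" where
  "is_funct C D T \<longleftrightarrow>
     FO T \<in> Obj C \<rightarrow>\<^sub>E Obj D \<and> FA T \<in> Arr C \<rightarrow>\<^sub>E Arr D \<and>
     (\<forall>f\<in>Arr C. Dom D (FA T f) = FO T (Dom C f) \<and> Cod D (FA T f) = FO T (Cod C f)) \<and>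
     (\<forall>A\<in>Obj C. FA T (Ide C A) = Ide D (FO T A)) \<and>
     (\<forall>f\<in>Arr C. \<forall>g\<in>Arr C. Cod C f = Dom C g \<longrightarrow>
        FA T (g \<cdot>\<^bsub>C\<^esub> f) = FA T g \<cdot>\<^bsub>D\<^esub> FA T f)"

definition id_funct :: "('o, 'a) cat \<Rightarrow> ('o, 'a, 'o, 'a) funct" where
  "id_funct C = \<lparr>FO = (\<lambda>A\<in>Obj C. A), FA = (\<lambda>f\<in>Arr C. f)\<rparr>"

definition comp_funct ::
  "('o, 'a) cat \<Rightarrow> ('p, 'b, 'q, 'c) funct \<Rightarrow> ('o, 'a, 'p, 'b) funct \<Rightarrow> ('o, 'a, 'q, 'c) funct" where
  "comp_funct C T S = \<lparr>FO = (\<lambda>A\<in>Obj C. FO T (FO S A)), FA = (\<lambda>f\<in>Arr C. FA T (FA S f))\<rparr>"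

record ('o, 'a, 'p, 'b) nattrans =
  NDom :: "('o, 'a, 'p, 'b) funct"
  NCod :: "('o, 'a, 'p, 'b) funct"
  NComp :: "'o \<Rightarrow> 'b"

definition is_nattrans :: "('o, 'a) cat \<Rightarrow> ('p, 'b) cat \<Rightarrow> ('o, 'a, 'p, 'b) nattrans \<Rightarrow> bool" where
  "is_nattrans C D t \<longleftrightarrow> is_funct C D (NDom t) \<and> is_funct C D (NCod t) \<and>
     NComp t \<in> extensional (Obj C) \<and>
     (\<forall>A\<in>Obj C. NComp t A \<in> Hom D (FO (NDom t) A) (FO (NCod t) A)) \<and>
     (\<forall>f\<in>Arr C. NComp t (Cod C f) \<cdot>\<^bsub>D\<^esub> FA (NDom t) f = FA (NCod t) f \<cdot>\<^bsub>D\<^esub> NComp t (Dom C f))"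

definition Fun ::
  "('o, 'a) cat \<Rightarrow> ('p, 'b) cat \<Rightarrow> (('o, 'a, 'p, 'b) funct, ('o, 'a, 'p, 'b) nattrans) cat" where
  "Fun C D = \<lparr>Obj = {T. is_funct C D T}, Arr = {t. is_nattrans C D t}, Dom = NDom, Cod = NCod,
     Ide = (\<lambda>T. \<lparr>NDom = T, NCod = T, NComp = (\<lambda>A\<in>Obj C. Ide D (FO T A))\<rparr>),
     Comp = (\<lambda>t s. \<lparr>NDom = NDom s, NCod = NCod t,
                    NComp = (\<lambda>A\<in>Obj C. NComp t A \<cdot>\<^bsub>D\<^esub> NComp s A)\<rparr>)\<rparr>"

definition whisker ::
  "('o, 'a) cat \<Rightarrow> ('p, 'b, 'q, 'c) nattrans \<Rightarrow> ('o, 'a, 'p, 'b) funct \<Rightarrow> ('o, 'a, 'q, 'c) nattrans" where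
  "whisker C t S = \<lparr>NDom = comp_funct C (NDom t) S, NCod = comp_funct C (NCod t) S,
     NComp = (\<lambda>A\<in>Obj C. NComp t (FO S A))\<rparr>"

text \<open>Since arrows of the opposite category are the original arrows, a functor and its opposite
  are the same record; the opposite of a natural transformation has the same components and
  the opposite direction.\<close>

definition op_nattrans :: "('o, 'a, 'p, 'b) nattrans \<Rightarrow> ('o, 'a, 'p, 'b) nattrans" where
  "op_nattrans t = \<lparr>NDom = NCod t, NCod = NDom t, NComp = NComp t\<rparr>"


section \<open>Subobjects and preradicals\<close>

definition monos_into :: "('o, 'a) cat \<Rightarrow> 'o \<Rightarrow> 'a set" where
  "monos_into C X = {m. is_mono C m \<and> Cod C m = X}"

definition sub_equiv :: "('o, 'a) cat \<Rightarrow> 'o \<Rightarrow> ('a \<times> 'a) set" where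
  "sub_equiv C X = {(m, n). m \<in> monos_into C X \<and> n \<in> monos_into C X \<and>
     (\<exists>u\<in>Hom C (Dom C m) (Dom C n). n \<cdot>\<^bsub>C\<^esub> u = m) \<and>
     (\<exists>v\<in>Hom C (Dom C n) (Dom C m). m \<cdot>\<^bsub>C\<^esub> v = n)}"

type_synonym ('o, 'a) prerad = "('o, 'a, 'o, 'a) nattrans set"

definition Pr :: "('o, 'a) cat \<Rightarrow> ('o, 'a) prerad set" where
  "Pr C = monos_into (Fun C C) (id_funct C) // sub_equiv (Fun C C) (id_funct C)"

definition pr_class :: "('o, 'a) cat \<Rightarrow> ('o, 'a, 'o, 'a) nattrans \<Rightarrow> ('o, 'a) prerad" where
  "pr_class C t = sub_equiv (Fun C C) (id_funct C) `` {t}"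

text \<open>Operations on equivalence classes are unions over all representatives, and over all
  choices of cokernels and pullbacks; in an abelian category all these classes coincide.\<close>

definition pr_dual :: "('o, 'a) cat \<Rightarrow> ('o, 'a) prerad \<Rightarrow> ('o, 'a) prerad" where
  "pr_dual C X = (\<Union>\<tau>\<in>X. \<Union>\<tau>'\<in>{t. is_cokernel (Fun C C) t \<tau>}.
     pr_class (op_cat C) (op_nattrans \<tau>'))"

definition pr_prod :: "('o, 'a) cat \<Rightarrow> ('o, 'a) prerad \<Rightarrow> ('o, 'a) prerad \<Rightarrow> ('o, 'a) prerad" where
  "pr_prod C X Y = (\<Union>\<tau>\<in>X. \<Union>\<sigma>\<in>Y.
     pr_class C (\<sigma> \<cdot>\<^bsub>Fun C C\<^esub> whisker C \<tau> (NDom \<sigma>)))"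

text \<open>With X the class of \<open>\<sigma>\<close> and Y the class of \<open>\<tau>\<close>, this is the coproduct \<open>(\<sigma> : \<tau>)\<close>;
  \<open>\<sigma>'\<close> is the cokernel of \<open>\<sigma>\<close>, with codomain the functor written S* on paper.\<close>

definition pr_coprod :: "('o, 'a) cat \<Rightarrow> ('o, 'a) prerad \<Rightarrow> ('o, 'a) prerad \<Rightarrow> ('o, 'a) prerad" where
  "pr_coprod C X Y = (\<Union>\<sigma>\<in>X. \<Union>\<tau>\<in>Y. \<Union>\<sigma>'\<in>{t. is_cokernel (Fun C C) t \<sigma>}.
     \<Union>q\<in>{q. \<exists>p. is_pullback (Fun C C) (whisker C \<tau> (NCod \<sigma>')) \<sigma>' p q}. pr_class C q)"

end

theory Submission
  imports Defs
begin

text \<open>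
  Kernels and cokernels in a functor category into an abelian category are computed pointwise, so
  preradicals correspond to their cokernels. Pulling back the kernel of \<open>g\<close> along
  \<open>f\<close> yields the kernel of \<open>g f\<close>; applied to \<open>\<tau> S*\<close>, the kernel of
  \<open>\<tau>* S*\<close>, this shows that \<open>(\<sigma> : \<tau>)\<close> is the kernel of the epimorphism
  \<open>\<tau>* S* \<circ> \<sigma>*\<close>. The cokernel of \<open>(\<sigma> : \<tau>)\<close> is therefore that
  composite, which read in the opposite category is \<open>\<Delta>(\<tau>) \<cdot> \<Delta>(\<sigma>)\<close>.
  Since \<open>\<Delta>\<close> is an involution, (b) is (a) for the opposite category.
\<close>

section \<open>Categories and duality\<close>

text \<open>Two obstacles shape the proof. Preradical classes are unions over all representatives,
  cokernels and pullbacks, so each operation must be shown independent of these choices. The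
  preorder \<open>factors\<close> does this: \<Delta> reverses it, the product is monotone for it,
  and monotonicity of the coproduct is read off from that of the product in \<open>op_cat C\<close>.
  Secondly, a natural transformation stores its source and target, so
  \<open>Fun (op_cat C) (op_cat C)\<close> is not literally \<open>op_cat (Fun C C)\<close>. The two
  are isomorphic through \<open>op_nattrans\<close>, and statements on monos, kernels and zero
  objects must be carried across. That a mono of the functor category is the kernel of its cokernel
  is deduced from the same fact in each component, so monos must first be shown to be pointwise
  monos. This is where the additive structure enters: an arrow that kills only zero arrows is
  mono.\<close>

lemma op_cat_simps [simp]:
  "Obj (op_cat C) = Obj C" "Arr (op_cat C) = Arr C"
  "Dom (op_cat C) = Cod C" "Cod (op_cat C) = Dom C" "Ide (op_cat C) = Ide C"
  "g \<cdot>\<^bsub>op_cat C\<^esub> f = f \<cdot>\<^bsub>C\<^esub> g"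
  by (simp_all add: op_cat_def)

lemma op_op_cat [simp]: "op_cat (op_cat C) = (C :: ('o, 'a) cat)"
  by (simp add: op_cat_def)

lemma Hom_op_cat [simp]: "Hom (op_cat C) A B = Hom C B A"
  by (auto simp: Hom_def)

lemma mem_Hom_iff: "f \<in> Hom C A B \<longleftrightarrow> f \<in> Arr C \<and> Dom C f = A \<and> Cod C f = B"
  by (simp add: Hom_def)

lemma is_zero_obj_op_cat [simp]: "is_zero_obj (op_cat C) Z \<longleftrightarrow> is_zero_obj (C :: ('o, 'a) cat) Z"
  by (auto simp: is_zero_obj_def)

lemma is_zero_arr_op_cat [simp]: "is_zero_arr (op_cat C) f \<longleftrightarrow> is_zero_arr (C :: ('o, 'a) cat) f"
  by (fastforce simp: is_zero_arr_def)

text \<open>On monos into one object, \<open>factors\<close> in both directions is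
  \<open>sub_equiv\<close>. Arbitrary arrows are allowed so that, taken in \<open>op_cat C\<close>,
  the same relation also compares quotients.\<close>

definition factors :: "('o, 'a) cat \<Rightarrow> 'a \<Rightarrow> 'a \<Rightarrow> bool" where
  "factors C m n \<longleftrightarrow> (\<exists>u\<in>Arr C. Dom C u = Dom C m \<and> Cod C u = Dom C n \<and> n \<cdot>\<^bsub>C\<^esub> u = m)"

context category
begin

lemma comp_simps [simp]:
  assumes "f \<in> Arr C" "g \<in> Arr C" "Cod C f = Dom C g"
  shows "g \<cdot> f \<in> Arr C" "Dom C (g \<cdot> f) = Dom C f" "Cod C (g \<cdot> f) = Cod C g"
  using comp_hom[of f "Dom C f" "Cod C f" g "Cod C g"] assms by (auto simp: mem_Hom_iff)

lemma ide_simps [simp]: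
  assumes "A \<in> Obj C"
  shows "Ide C A \<in> Arr C" "Dom C (Ide C A) = A" "Cod C (Ide C A) = A"
  using ide_hom[OF assms] by (auto simp: mem_Hom_iff)

lemma assoc [simp]:
  assumes "f \<in> Arr C" "g \<in> Arr C" "h \<in> Arr C" "Cod C f = Dom C g" "Cod C g = Dom C h"
  shows "(h \<cdot> g) \<cdot> f = h \<cdot> (g \<cdot> f)"
  using comp_assoc[of f "Dom C f" "Cod C f" g "Cod C g" h "Cod C h"] assms
  by (auto simp: mem_Hom_iff)

text \<open>The simplifier nests composites to the right, which hides the left-hand side of a
  commuting square once an arrow is precomposed. This rule applies the square inside such a
  composite.\<close>

lemma comp_eq_extend:
  assumes "g \<cdot> f = k \<cdot> h" "f \<in> Arr C" "g \<in> Arr C" "h \<in> Arr C" "k \<in> Arr C" "x \<in> Arr C"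
    "Cod C f = Dom C g" "Cod C h = Dom C k" "Cod C x = Dom C f" "Cod C x = Dom C h"
  shows "g \<cdot> (f \<cdot> x) = k \<cdot> (h \<cdot> x)"
  using assms assoc[of x f g] assoc[of x h k] by simp

declare dom_obj [simp] cod_obj [simp]

lemma comp_Ide [simp]: "f \<in> Arr C \<Longrightarrow> Dom C f = A \<Longrightarrow> f \<cdot> Ide C A = f"
  using comp_ide_right by blast

lemma Ide_comp [simp]: "f \<in> Arr C \<Longrightarrow> Cod C f = B \<Longrightarrow> Ide C B \<cdot> f = f"
  using comp_ide_left by blast

lemma category_op_cat: "category (op_cat C)"
  by unfold_locales (auto simp: mem_Hom_iff)

lemma is_mono_arr: "is_mono C m \<Longrightarrow> m \<in> Arr C"
  by (simp add: is_mono_def)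

lemma is_mono_cancel:
  assumes "is_mono C m" "g \<in> Arr C" "h \<in> Arr C" "Cod C g = Dom C m" "Cod C h = Dom C m"
    "Dom C g = Dom C h" "m \<cdot> g = m \<cdot> h"
  shows "g = h"
  using assms unfolding is_mono_def by blast

lemma is_mono_comp:
  assumes "is_mono C m" "is_mono C n" "Cod C m = Dom C n"
  shows "is_mono C (n \<cdot> m)"
proof -
  have mn: "m \<in> Arr C" "n \<in> Arr C"
    using assms(1,2) by (simp_all add: is_mono_def)
  have "g = h" if gh: "g \<in> Arr C" "h \<in> Arr C" "Cod C g = Dom C m" "Cod C h = Dom C m"
    "Dom C g = Dom C h" "(n \<cdot> m) \<cdot> g = (n \<cdot> m) \<cdot> h" for g h
  proof -
    have mgh: "m \<cdot> g = m \<cdot> h"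
      by (rule is_mono_cancel[OF assms(2)]) (use gh mn assms in auto)
    show ?thesis
      by (rule is_mono_cancel[OF assms(1)]) (use gh mgh in auto)
  qed
  then show ?thesis
    using mn assms by (auto simp: is_mono_def)
qed

section \<open>Zero objects and zero arrows\<close>

lemma is_zero_arr_arr: "is_zero_arr C f \<Longrightarrow> f \<in> Arr C"
  by (simp add: is_zero_arr_def)

lemma is_zero_arrE:
  assumes "is_zero_arr C f"
  obtains Z a b where "is_zero_obj C Z" "a \<in> Hom C (Dom C f) Z" "b \<in> Hom C Z (Cod C f)"
    "f = b \<cdot> a"
  using assms by (auto simp: is_zero_arr_def)

lemma is_zero_arr_comp_right:
  assumes "is_zero_arr C f" "g \<in> Arr C" "Cod C g = Dom C f"
  shows "is_zero_arr C (f \<cdot> g)"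
proof -
  obtain Z a b where Z: "is_zero_obj C Z" and ab: "a \<in> Hom C (Dom C f) Z" "b \<in> Hom C Z (Cod C f)"
    and f: "f = b \<cdot> a"
    using assms(1) by (rule is_zero_arrE)
  have fA: "f \<in> Arr C"
    using assms(1) by (rule is_zero_arr_arr)
  have "f \<cdot> g = b \<cdot> (a \<cdot> g)"
    by (subst f, rule assoc) (use ab assms in \<open>simp_all add: mem_Hom_iff\<close>)
  moreover have "a \<cdot> g \<in> Hom C (Dom C (f \<cdot> g)) Z" "b \<in> Hom C Z (Cod C (f \<cdot> g))"
    using ab fA assms by (auto simp: mem_Hom_iff)
  moreover have "f \<cdot> g \<in> Arr C"
    using fA assms by simp
  ultimately show ?thesis
    using Z unfolding is_zero_arr_def by blast
qed

lemma is_zero_arr_comp_left: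
  assumes "is_zero_arr C f" "g \<in> Arr C" "Dom C g = Cod C f"
  shows "is_zero_arr C (g \<cdot> f)"
  using category.is_zero_arr_comp_right[OF category_op_cat, of f g] assms by simp

lemma zero_obj_to_unique:
  assumes "is_zero_obj C Z" "f \<in> Arr C" "g \<in> Arr C" "Dom C f = Dom C g" "Cod C f = Z" "Cod C g = Z"
  shows "f = g"
proof -
  have "Dom C f \<in> Obj C"
    using assms by simp
  then show ?thesis
    using assms unfolding is_zero_obj_def is_terminal_def mem_Hom_iff by metis
qed

lemma zero_obj_from_unique:
  assumes "is_zero_obj C Z" "f \<in> Arr C" "g \<in> Arr C" "Cod C f = Cod C g" "Dom C f = Z" "Dom C g = Z"
  shows "f = g"
  using category.zero_obj_to_unique[OF category_op_cat, of Z f g] assms by simp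

lemma zero_obj_arr_to:
  assumes "is_zero_obj C Z" "A \<in> Obj C"
  obtains f where "f \<in> Arr C" "Dom C f = A" "Cod C f = Z"
  using assms unfolding is_zero_obj_def is_terminal_def mem_Hom_iff by blast

lemma zero_obj_arr_from:
  assumes "is_zero_obj C Z" "A \<in> Obj C"
  obtains f where "f \<in> Arr C" "Dom C f = Z" "Cod C f = A"
  using category.zero_obj_arr_to[OF category_op_cat, of Z A] assms by auto

lemma is_zero_arr_unique:
  assumes "is_zero_arr C f" "is_zero_arr C g" "Dom C f = Dom C g" "Cod C f = Cod C g"
  shows "f = g"
proof -
  obtain Z a b where Z: "is_zero_obj C Z" and ab: "a \<in> Hom C (Dom C f) Z" "b \<in> Hom C Z (Cod C f)"
    and f: "f = b \<cdot> a"
    using assms(1) by (rule is_zero_arrE)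
  obtain Y c d where Y: "is_zero_obj C Y" and cd: "c \<in> Hom C (Dom C g) Y" "d \<in> Hom C Y (Cod C g)"
    and g: "g = d \<cdot> c"
    using assms(2) by (rule is_zero_arrE)
  have "Z \<in> Obj C"
    using Z by (simp add: is_zero_obj_def is_terminal_def)
  \<comment> \<open>The two zero arrows may pass through different zero objects. The comparison w
    gives \<open>c = w \<cdot> a\<close> and \<open>b = d \<cdot> w\<close>, so both composites
    equal d w a.\<close>
  then obtain w where w: "w \<in> Arr C" "Dom C w = Z" "Cod C w = Y"
    using zero_obj_arr_to[OF Y] by blast
  have "c = w \<cdot> a"
    by (rule zero_obj_to_unique[OF Y]) (use cd ab w assms in \<open>auto simp: mem_Hom_iff\<close>)
  moreover have "b = d \<cdot> w"
    by (rule zero_obj_from_unique[OF Z]) (use cd ab w assms in \<open>auto simp: mem_Hom_iff\<close>)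
  ultimately have "b \<cdot> a = d \<cdot> c"
    using w ab cd by (simp add: mem_Hom_iff)
  then show ?thesis
    using f g by simp
qed

lemma is_zero_arr_through:
  assumes "is_zero_obj C Z" "a \<in> Arr C" "b \<in> Arr C" "Cod C a = Z" "Dom C b = Z"
  shows "is_zero_arr C (b \<cdot> a)"
proof -
  have "b \<cdot> a \<in> Arr C" "a \<in> Hom C (Dom C (b \<cdot> a)) Z" "b \<in> Hom C Z (Cod C (b \<cdot> a))"
    using assms by (auto simp: mem_Hom_iff)
  then show ?thesis
    using assms(1) unfolding is_zero_arr_def by blast
qed

section \<open>Kernels\<close>

lemma is_kernelD:
  assumes "is_kernel C k f"
  shows "f \<in> Arr C" "k \<in> Arr C" "Cod C k = Dom C f" "is_zero_arr C (f \<cdot> k)"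
  using assms by (auto simp: is_kernel_def)

lemma is_kernel_lift:
  assumes "is_kernel C k f" "h \<in> Arr C" "Cod C h = Dom C f" "is_zero_arr C (f \<cdot> h)"
  obtains u where "u \<in> Arr C" "Dom C u = Dom C h" "Cod C u = Dom C k" "k \<cdot> u = h"
  using assms unfolding is_kernel_def mem_Hom_iff by blast

text \<open>Both g and h are lifts of the single arrow \<open>k \<cdot> g\<close>, which f kills;
  uniqueness of the lift identifies them.\<close>

lemma is_kernel_mono:
  assumes "is_kernel C k f"
  shows "is_mono C k"
proof -
  note k = is_kernelD[OF assms]
  have "g = h" if gh: "g \<in> Arr C" "h \<in> Arr C" "Cod C g = Dom C k" "Cod C h = Dom C k"
    "Dom C g = Dom C h" "k \<cdot> g = k \<cdot> h" for g h
  proof -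
    have "is_zero_arr C ((f \<cdot> k) \<cdot> g)"
      by (rule is_zero_arr_comp_right) (use k gh in auto)
    then have "is_zero_arr C (f \<cdot> (k \<cdot> g))"
      using k gh by simp
    then have "\<exists>!u. u \<in> Hom C (Dom C (k \<cdot> g)) (Dom C k) \<and> k \<cdot> u = k \<cdot> g"
      using assms k gh unfolding is_kernel_def by (metis comp_simps)
    moreover have "g \<in> Hom C (Dom C (k \<cdot> g)) (Dom C k)" "h \<in> Hom C (Dom C (k \<cdot> g)) (Dom C k)"
      using gh k by (auto simp: mem_Hom_iff)
    ultimately show ?thesis
      using gh by metis
  qed
  then show ?thesis
    using k by (auto simp: is_mono_def)
qed

text \<open>Being mono supplies the uniqueness half of the universal property, so only existence of
  a lift is left to check.\<close>

lemma is_kernelI: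
  assumes "f \<in> Arr C" "Cod C k = Dom C f" "is_zero_arr C (f \<cdot> k)" "is_mono C k"
    and "\<And>h. h \<in> Arr C \<Longrightarrow> Cod C h = Dom C f \<Longrightarrow> is_zero_arr C (f \<cdot> h) \<Longrightarrow>
      \<exists>u\<in>Arr C. Dom C u = Dom C h \<and> Cod C u = Dom C k \<and> k \<cdot> u = h"
  shows "is_kernel C k f"
proof -
  have "\<exists>!u. u \<in> Hom C (Dom C h) (Dom C k) \<and> k \<cdot> u = h"
    if h: "h \<in> Arr C" "Cod C h = Dom C f" "is_zero_arr C (f \<cdot> h)" for h
  proof -
    obtain u where u: "u \<in> Arr C" "Dom C u = Dom C h" "Cod C u = Dom C k" "k \<cdot> u = h"
      using assms(5)[OF h] by blast
    then show ?thesis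
      using is_mono_cancel[OF assms(4)] by (intro ex1I[of _ u]) (auto simp: mem_Hom_iff)
  qed
  then show ?thesis
    using assms is_mono_arr[OF assms(4)] by (auto simp: is_kernel_def)
qed

section \<open>The factorisation preorder and kernels\<close>

lemma factors_refl: "m \<in> Arr C \<Longrightarrow> factors C m m"
  unfolding factors_def by (intro bexI[of _ "Ide C (Dom C m)"]) auto

lemma factors_trans:
  assumes "factors C l m" "factors C m n" "n \<in> Arr C"
  shows "factors C l n"
proof -
  obtain u where u: "u \<in> Arr C" "Dom C u = Dom C l" "Cod C u = Dom C m" "m \<cdot> u = l"
    using assms(1) unfolding factors_def by blast
  obtain v where v: "v \<in> Arr C" "Dom C v = Dom C m" "Cod C v = Dom C n" "n \<cdot> v = m"
    using assms(2) unfolding factors_def by blast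
  show ?thesis
    unfolding factors_def using u v assms(3) by (intro bexI[of _ "v \<cdot> u"]) (auto simp flip: assoc)
qed

lemma is_kernel_factors:
  assumes "is_kernel C k f" "h \<in> Arr C" "Cod C h = Dom C f" "is_zero_arr C (f \<cdot> h)"
  shows "factors C h k"
  using is_kernel_lift[OF assms] unfolding factors_def by metis

lemma factors_comp_zero:
  assumes "factors C m n" "n \<in> Arr C" "f \<in> Arr C" "Dom C f = Cod C n" "is_zero_arr C (f \<cdot> n)"
  shows "is_zero_arr C (f \<cdot> m)"
proof -
  obtain u where u: "u \<in> Arr C" "Dom C u = Dom C m" "Cod C u = Dom C n" "n \<cdot> u = m"
    using assms(1) unfolding factors_def by blast
  have "is_zero_arr C ((f \<cdot> n) \<cdot> u)"
    by (rule is_zero_arr_comp_right) (use assms u in auto)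
  then show ?thesis
    using assms u by simp
qed

text \<open>Zero composites and lifts both pass along \<open>factors\<close>. This lets an arbitrary
  kernel be exchanged for one that was constructed explicitly.\<close>

lemma is_kernel_cong:
  assumes "is_kernel C k f" "is_mono C n" "Cod C n = Cod C k" "factors C n k" "factors C k n"
  shows "is_kernel C n f"
proof (rule is_kernelI)
  note k = is_kernelD[OF assms(1)]
  note n = is_mono_arr[OF assms(2)]
  show "f \<in> Arr C" "Cod C n = Dom C f" "is_mono C n"
    using k assms by auto
  show "is_zero_arr C (f \<cdot> n)"
    using factors_comp_zero[OF assms(4)] k by simp
  fix h assume h: "h \<in> Arr C" "Cod C h = Dom C f" "is_zero_arr C (f \<cdot> h)"
  have "factors C h n"
    using factors_trans[OF is_kernel_factors[OF assms(1) h] assms(5) n] .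
  then show "\<exists>u\<in>Arr C. Dom C u = Dom C h \<and> Cod C u = Dom C n \<and> n \<cdot> u = h"
    by (simp add: factors_def)
qed

text \<open>Order reversal: \<open>factors (op_cat C) e' e\<close> says that \<open>e'\<close> is \<open>e\<close> followed by some arrow.\<close>

lemma kernels_factor:
  assumes "is_kernel C k e" "is_kernel C k' e'" "factors (op_cat C) e' e"
  shows "factors C k k'"
proof -
  note k = is_kernelD[OF assms(1)] and k' = is_kernelD[OF assms(2)]
  have d: "Dom C e = Dom C e'"
    using assms(3) k k' unfolding factors_def by auto
  have "is_zero_arr C (e' \<cdot> k)"
    using category.factors_comp_zero[OF category_op_cat assms(3), of k] k by simp
  then show ?thesis
    using is_kernel_factors[OF assms(2)] k d by simp
qed

lemma cokernels_factor:
  assumes "is_cokernel C e k" "is_cokernel C e' k'" "factors C k k'"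
  shows "factors (op_cat C) e' e"
  using category.kernels_factor[OF category_op_cat, of e' k' e k] assms
  by (simp add: is_cokernel_def)

text \<open>Since f kills k, it is q followed by some arrow. Whatever q kills is therefore killed by
  f and lifts through k.\<close>

lemma kernel_of_cokernel:
  assumes "is_kernel C k f" "is_cokernel C q k"
  shows "is_kernel C k q"
proof -
  interpret op: category "op_cat C"
    by (rule category_op_cat)
  note k = is_kernelD[OF assms(1)]
  note q = op.is_kernelD[OF assms(2)[unfolded is_cokernel_def], simplified]
  have fq: "factors (op_cat C) f q"
    using op.is_kernel_factors[OF assms(2)[unfolded is_cokernel_def], of f] k by simp
  show ?thesis
  proof (rule is_kernelI)
    show "q \<in> Arr C" "Cod C k = Dom C q" "is_zero_arr C (q \<cdot> k)" "is_mono C k"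
      using q is_kernel_mono[OF assms(1)] by auto
    fix h assume h: "h \<in> Arr C" "Cod C h = Dom C q" "is_zero_arr C (q \<cdot> h)"
    have "is_zero_arr C (f \<cdot> h)"
      using op.factors_comp_zero[OF fq, of h] h q by simp
    then have "factors C h k"
      using is_kernel_factors[OF assms(1)] h k q by simp
    then show "\<exists>u\<in>Arr C. Dom C u = Dom C h \<and> Cod C u = Dom C k \<and> k \<cdot> u = h"
      by (simp add: factors_def)
  qed
qed

lemma pullback_of_kernel_iff:
  assumes "is_kernel C m g" "f \<in> Arr C" "Cod C f = Dom C g"
  shows "(\<exists>p. is_pullback C m f p q) \<longleftrightarrow> is_kernel C q (g \<cdot> f)"
proof
  note m = is_kernelD[OF assms(1)] and mono = is_kernel_mono[OF assms(1)]
  assume "\<exists>p. is_pullback C m f p q"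
  then obtain p where p: "p \<in> Arr C" "q \<in> Arr C" "Dom C p = Dom C q" "Cod C p = Dom C m"
    "Cod C q = Dom C f" "m \<cdot> p = f \<cdot> q"
    and univ: "\<And>X a b. X \<in> Obj C \<Longrightarrow> a \<in> Hom C X (Dom C m) \<Longrightarrow> b \<in> Hom C X (Dom C f) \<Longrightarrow>
      m \<cdot> a = f \<cdot> b \<Longrightarrow> \<exists>!u. u \<in> Hom C X (Dom C p) \<and> p \<cdot> u = a \<and> q \<cdot> u = b"
    unfolding is_pullback_def by blast
  have monoq: "is_mono C q"
    unfolding is_mono_def
  proof (intro conjI ballI impI)
    show "q \<in> Arr C"
      by fact
    fix a b assume ab: "a \<in> Arr C" "b \<in> Arr C"
      "Cod C a = Dom C q \<and> Cod C b = Dom C q \<and> Dom C a = Dom C b \<and> q \<cdot> a = q \<cdot> b"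
    have fq: "m \<cdot> (p \<cdot> a) = f \<cdot> (q \<cdot> a)" "m \<cdot> (p \<cdot> b) = f \<cdot> (q \<cdot> b)"
      by (rule comp_eq_extend; use ab p m assms in simp)+
    \<comment> \<open>The first projection is determined by the second because m is mono, so
      equality after q already gives two mediating arrows with the same data.\<close>
    have pab: "p \<cdot> a = p \<cdot> b"
      by (rule is_mono_cancel[OF mono]) (use ab p fq in auto)
    have "\<exists>!u. u \<in> Hom C (Dom C a) (Dom C p) \<and> p \<cdot> u = p \<cdot> a \<and> q \<cdot> u = q \<cdot> a"
      using ab p \<open>m \<cdot> (p \<cdot> a) = f \<cdot> (q \<cdot> a)\<close> by (intro univ) (auto simp: mem_Hom_iff)
    moreover have "a \<in> Hom C (Dom C a) (Dom C p)" "b \<in> Hom C (Dom C a) (Dom C p)"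
      using ab p by (auto simp: mem_Hom_iff)
    ultimately show "a = b"
      using pab ab by metis
  qed
  show "is_kernel C q (g \<cdot> f)"
  proof (rule is_kernelI)
    show "g \<cdot> f \<in> Arr C" "Cod C q = Dom C (g \<cdot> f)" "is_mono C q"
      using p assms m monoq by auto
    have "is_zero_arr C ((g \<cdot> m) \<cdot> p)"
      by (rule is_zero_arr_comp_right) (use p m in auto)
    then show "is_zero_arr C ((g \<cdot> f) \<cdot> q)"
      using p m assms by simp
    fix h assume h: "h \<in> Arr C" "Cod C h = Dom C (g \<cdot> f)" "is_zero_arr C ((g \<cdot> f) \<cdot> h)"
    have "is_zero_arr C (g \<cdot> (f \<cdot> h))" "f \<cdot> h \<in> Arr C" "Cod C (f \<cdot> h) = Dom C g"
      using h m assms by auto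
    then obtain a where a: "a \<in> Arr C" "Dom C a = Dom C (f \<cdot> h)" "Cod C a = Dom C m" "m \<cdot> a = f \<cdot> h"
      using is_kernel_lift[OF assms(1)] by metis
    have "\<exists>!u. u \<in> Hom C (Dom C h) (Dom C p) \<and> p \<cdot> u = a \<and> q \<cdot> u = h"
      using a h m assms by (intro univ) (auto simp: mem_Hom_iff)
    then show "\<exists>u\<in>Arr C. Dom C u = Dom C h \<and> Cod C u = Dom C q \<and> q \<cdot> u = h"
      using p by (auto simp: mem_Hom_iff)
  qed
next
  note m = is_kernelD[OF assms(1)] and mono = is_kernel_mono[OF assms(1)]
  assume ker: "is_kernel C q (g \<cdot> f)"
  note q = is_kernelD[OF ker]
  have "is_zero_arr C (g \<cdot> (f \<cdot> q))" "f \<cdot> q \<in> Arr C" "Cod C (f \<cdot> q) = Dom C g" "Cod C q = Dom C f"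
    using q m assms by auto
  then obtain p where p: "p \<in> Arr C" "Dom C p = Dom C (f \<cdot> q)" "Cod C p = Dom C m" "m \<cdot> p = f \<cdot> q"
    using is_kernel_lift[OF assms(1)] by metis
  note q = q \<open>Cod C q = Dom C f\<close>
  have "\<exists>!u. u \<in> Hom C X (Dom C p) \<and> p \<cdot> u = a \<and> q \<cdot> u = b"
    if ab: "a \<in> Hom C X (Dom C m)" "b \<in> Hom C X (Dom C f)" "m \<cdot> a = f \<cdot> b" for X a b
  proof -
    have "is_zero_arr C ((g \<cdot> m) \<cdot> a)"
      by (rule is_zero_arr_comp_right) (use ab m in \<open>auto simp: mem_Hom_iff\<close>)
    then have "is_zero_arr C ((g \<cdot> f) \<cdot> b)"
      using ab m assms by (simp add: mem_Hom_iff)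
    moreover have "b \<in> Arr C" "Cod C b = Dom C (g \<cdot> f)"
      using ab m assms by (auto simp: mem_Hom_iff)
    ultimately obtain u where u: "u \<in> Arr C" "Dom C u = Dom C b" "Cod C u = Dom C q" "q \<cdot> u = b"
      using is_kernel_lift[OF ker] by metis
    have "m \<cdot> (p \<cdot> u) = (f \<cdot> q) \<cdot> u"
      using p q u m assms by (simp flip: assoc)
    also have "\<dots> = m \<cdot> a"
      using p q u m assms ab by simp
    finally have mpu: "m \<cdot> (p \<cdot> u) = m \<cdot> a" .
    have "p \<cdot> u = a"
      by (rule is_mono_cancel[OF mono]) (use mpu ab u p q assms in \<open>auto simp: mem_Hom_iff\<close>)
    moreover have "u \<in> Hom C X (Dom C p)"
      using u ab p q assms by (simp add: mem_Hom_iff)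
    \<comment> \<open>The kernel q is mono, so its leg alone determines the mediating arrow.\<close>
    moreover have "v = u" if "v \<in> Hom C X (Dom C p)" "q \<cdot> v = b" for v
      by (rule is_mono_cancel[OF is_kernel_mono[OF ker]]) (use that u p q assms ab in \<open>auto simp: mem_Hom_iff\<close>)
    ultimately show ?thesis
      using u(4) by (intro ex1I[of _ u]) blast+
  qed
  then have "is_pullback C m f p q"
    unfolding is_pullback_def using p q m assms by simp
  then show "\<exists>p. is_pullback C m f p q" ..
qed

end

section \<open>Normal categories\<close>

text \<open>The self-dual exactness part of the abelian axioms. It is the form in which these axioms
  are established for functor categories, where it makes a mono the kernel of its cokernel and an
  epi the cokernel of its kernel.\<close>

locale normal_category = category +
  assumes has_zero: "\<exists>Z. is_zero_obj C Z"
    and has_kernels: "f \<in> Arr C \<Longrightarrow> \<exists>k. is_kernel C k f"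
    and has_cokernels: "f \<in> Arr C \<Longrightarrow> \<exists>q. is_cokernel C q f"
    and mono_normal: "is_mono C m \<Longrightarrow> \<exists>f. is_kernel C m f"
    and epi_normal: "is_epi C e \<Longrightarrow> \<exists>f. is_cokernel C e f"
begin

lemma normal_category_op_cat: "normal_category (op_cat C)"
proof -
  interpret op: category "op_cat C"
    by (rule category_op_cat)
  show ?thesis
    using has_zero has_kernels has_cokernels mono_normal epi_normal
    by unfold_locales (auto simp: is_cokernel_def is_epi_def)
qed

lemma mono_is_kernel:
  assumes "is_mono C m" "is_cokernel C q m"
  shows "is_kernel C m q"
  using mono_normal[OF assms(1)] kernel_of_cokernel assms(2) by blast

lemma epi_is_cokernel:
  assumes "is_epi C e" "is_kernel C k e"
  shows "is_cokernel C e k"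
  using normal_category.mono_is_kernel[OF normal_category_op_cat, of e k] assms
  by (simp add: is_epi_def is_cokernel_def)

end

sublocale abelian_category \<subseteq> normal_category
  using has_zero has_kernels has_cokernels mono_normal epi_normal by unfold_locales

context abelian_category
begin

lemma abelian_category_op_cat: "abelian_category (op_cat C)"
proof -
  interpret op: category "op_cat C"
    by (rule category_op_cat)
  obtain add zer where "is_Ab_enrichment C add zer"
    using ab_enriched by blast
  \<comment> \<open>Addition is unchanged, but the neutral element of a hom-set is indexed by source
    and target, which trade places.\<close>
  then have "is_Ab_enrichment (op_cat C) add (\<lambda>A B. zer B A)"
    unfolding is_Ab_enrichment_def by auto
  then show ?thesis
    using has_zero has_kernels has_cokernels mono_normal epi_normal has_products has_coproducts
    by unfold_locales (auto simp: is_cokernel_def is_epi_def)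
qed

text \<open>If f equalises g and h, it kills their difference, which is then a zero arrow. The
  enrichment names its neutral elements abstractly, so they must first be identified with arrows
  through a zero object.\<close>

lemma is_monoI_zero:
  assumes f: "f \<in> Arr C"
    and z: "\<And>g. g \<in> Arr C \<Longrightarrow> Cod C g = Dom C f \<Longrightarrow> is_zero_arr C (f \<cdot> g) \<Longrightarrow> is_zero_arr C g"
  shows "is_mono C f"
  unfolding is_mono_def
proof (intro conjI ballI impI f)
  fix g h
  assume gh: "g \<in> Arr C" "h \<in> Arr C"
    "Cod C g = Dom C f \<and> Cod C h = Dom C f \<and> Dom C g = Dom C h \<and> f \<cdot> g = f \<cdot> h"
  define A B where "A = Dom C g" and "B = Dom C f"
  have obj: "A \<in> Obj C" "B \<in> Obj C" "Cod C f \<in> Obj C"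
    using gh f by (auto simp: A_def B_def)
  have hom: "g \<in> Hom C A B" "h \<in> Hom C A B" "f \<in> Hom C B (Cod C f)"
    using gh f by (auto simp: A_def B_def mem_Hom_iff)
  obtain add zer where en: "is_Ab_enrichment C add zer"
    using ab_enriched by blast
  interpret G: comm_group "\<lparr>carrier = Hom C A B, monoid.mult = add, one = zer A B\<rparr>"
    using en obj unfolding is_Ab_enrichment_def by blast
  obtain Z where Z: "is_zero_obj C Z"
    using has_zero by blast
  have ZO: "Z \<in> Obj C"
    using Z by (simp add: is_zero_obj_def is_terminal_def)
  interpret GZ: comm_group "\<lparr>carrier = Hom C Z B, monoid.mult = add, one = zer Z B\<rparr>"
    using en obj ZO unfolding is_Ab_enrichment_def by blast
  obtain a where a: "a \<in> Arr C" "Dom C a = A" "Cod C a = Z"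
    using zero_obj_arr_to[OF Z obj(1)] by blast
  obtain b where b: "b \<in> Arr C" "Dom C b = Z" "Cod C b = B"
    using zero_obj_arr_from[OF Z obj(2)] by blast
  have ba: "b \<cdot> a \<in> Hom C A B" and zba: "is_zero_arr C (b \<cdot> a)"
    using a b is_zero_arr_through[OF Z] by (auto simp: mem_Hom_iff)
  \<comment> \<open>As Z is initial, \<open>add b b\<close> equals b. Distributing over a makes
    \<open>b \<cdot> a\<close> idempotent for addition, and an idempotent of a group is its neutral
    element.\<close>
  have "add b b \<in> Hom C Z B"
    using GZ.m_closed[of b b] b by (simp add: mem_Hom_iff)
  then have bb: "add b b = b"
    using b by (intro zero_obj_from_unique[OF Z]) (auto simp: mem_Hom_iff)
  have "\<forall>x\<in>Hom C A Z. \<forall>g\<in>Hom C Z B. \<forall>h\<in>Hom C Z B. add g h \<cdot> x = add (g \<cdot> x) (h \<cdot> x)"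
    using en obj ZO unfolding is_Ab_enrichment_def by blast
  moreover have "a \<in> Hom C A Z" "b \<in> Hom C Z B"
    using a b by (auto simp: mem_Hom_iff)
  ultimately have "add (b \<cdot> a) (b \<cdot> a) = b \<cdot> a"
    using bb by metis
  then have zer: "zer A B = b \<cdot> a"
    using G.l_cancel_one[of "b \<cdot> a" "b \<cdot> a"] ba by simp
  \<comment> \<open>The negative of h: \<open>add g h'\<close> is the difference that f kills, and
    once it is known to be \<open>zer A B\<close> it can be compared with
    \<open>add h h'\<close>.\<close>
  obtain h' where h': "h' \<in> Hom C A B" "add h h' = zer A B"
    using G.r_inv_ex[of h] hom by auto
  have gh': "add g h' \<in> Hom C A B"
    using G.m_closed[of g h'] h' hom by simp
  have distrib: "f \<cdot> add x y = add (f \<cdot> x) (f \<cdot> y)" if "x \<in> Hom C A B" "y \<in> Hom C A B" for x y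
    using en obj that hom(3) unfolding is_Ab_enrichment_def by blast
  have "f \<cdot> add g h' = f \<cdot> zer A B"
    using distrib[of g h'] distrib[of h h'] hom h' gh by simp
  moreover have "is_zero_arr C (f \<cdot> zer A B)"
    unfolding zer by (rule is_zero_arr_comp_left[OF zba]) (use ba f in \<open>auto simp: mem_Hom_iff B_def\<close>)
  ultimately have "is_zero_arr C (add g h')"
    using z gh' by (simp add: mem_Hom_iff B_def)
  then have "add g h' = b \<cdot> a"
    by (rule is_zero_arr_unique[OF _ zba]) (use gh' ba in \<open>auto simp: mem_Hom_iff\<close>)
  then have "add g h' = add h h'"
    using h' zer by simp
  then show "g = h"
    using G.right_cancel[of h' g h] hom h' by simp
qed

end

section \<open>Isomorphisms of categories\<close>

text \<open>An isomorphism of categories that is the identity on objects. It is used for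
  \<open>op_nattrans\<close>, where the objects agree because a functor and its opposite are the
  same record.\<close>

locale cat_iso = D: category D + E: category E
  for D :: "('o, 'a) cat" and E :: "('o, 'b) cat" +
  fixes \<phi> :: "'a \<Rightarrow> 'b" and \<psi> :: "'b \<Rightarrow> 'a"
  assumes Obj_eq: "Obj E = Obj D"
    and \<phi>_simps [simp]: "f \<in> Arr D \<Longrightarrow> \<phi> f \<in> Arr E" "f \<in> Arr D \<Longrightarrow> Dom E (\<phi> f) = Dom D f"
      "f \<in> Arr D \<Longrightarrow> Cod E (\<phi> f) = Cod D f" "f \<in> Arr D \<Longrightarrow> \<psi> (\<phi> f) = f"
    and \<psi>_simps [simp]: "g \<in> Arr E \<Longrightarrow> \<psi> g \<in> Arr D" "g \<in> Arr E \<Longrightarrow> \<phi> (\<psi> g) = g"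
    and \<phi>_comp: "f \<in> Arr D \<Longrightarrow> f' \<in> Arr D \<Longrightarrow> Cod D f = Dom D f' \<Longrightarrow>
      \<phi> (f' \<cdot>\<^bsub>D\<^esub> f) = \<phi> f' \<cdot>\<^bsub>E\<^esub> \<phi> f"
begin

lemma \<psi>_Dom [simp]: "g \<in> Arr E \<Longrightarrow> Dom D (\<psi> g) = Dom E g"
  using \<phi>_simps(2)[of "\<psi> g"] by simp

lemma \<psi>_Cod [simp]: "g \<in> Arr E \<Longrightarrow> Cod D (\<psi> g) = Cod E g"
  using \<phi>_simps(3)[of "\<psi> g"] by simp

lemma \<psi>_comp:
  assumes "f \<in> Arr E" "g \<in> Arr E" "Cod E f = Dom E g"
  shows "\<psi> (g \<cdot>\<^bsub>E\<^esub> f) = \<psi> g \<cdot>\<^bsub>D\<^esub> \<psi> f"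
  using \<phi>_comp[of "\<psi> f" "\<psi> g"] \<phi>_simps(4)[of "\<psi> g \<cdot>\<^bsub>D\<^esub> \<psi> f"] assms by simp

lemma cat_iso_sym: "cat_iso E D \<psi> \<phi>"
  by unfold_locales (auto simp: Obj_eq \<psi>_comp)

lemma cat_iso_op: "cat_iso (op_cat D) (op_cat E) \<phi> \<psi>"
  by (intro cat_iso.intro D.category_op_cat E.category_op_cat cat_iso_axioms.intro)
     (auto simp: Obj_eq \<phi>_comp)

lemma \<phi>_eq_iff: "f \<in> Arr D \<Longrightarrow> g \<in> Arr D \<Longrightarrow> \<phi> f = \<phi> g \<longleftrightarrow> f = g"
  by (metis \<phi>_simps(4))

lemma is_terminal_transfer:
  assumes "is_terminal D Z"
  shows "is_terminal E Z"
  unfolding is_terminal_def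
proof (intro conjI ballI)
  show "Z \<in> Obj E"
    using assms by (simp add: is_terminal_def Obj_eq)
  fix A assume "A \<in> Obj E"
  then obtain f where f: "f \<in> Hom D A Z" "\<And>g. g \<in> Hom D A Z \<Longrightarrow> g = f"
    using assms unfolding is_terminal_def Obj_eq by metis
  show "\<exists>!f. f \<in> Hom E A Z"
  proof (rule ex1I[of _ "\<phi> f"])
    show "\<phi> f \<in> Hom E A Z"
      using f(1) by (simp add: mem_Hom_iff)
    fix g assume g: "g \<in> Hom E A Z"
    then have "\<psi> g = f"
      by (intro f(2)) (simp add: mem_Hom_iff)
    then show "g = \<phi> f"
      using g by (auto simp: mem_Hom_iff)
  qed
qed

lemma is_zero_obj_transfer: "is_zero_obj D Z \<Longrightarrow> is_zero_obj E Z"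
  using is_terminal_transfer cat_iso.is_terminal_transfer[OF cat_iso_op]
  by (simp add: is_zero_obj_def)

lemma is_zero_arr_transfer:
  assumes "is_zero_arr D f"
  shows "is_zero_arr E (\<phi> f)"
proof -
  obtain Z a b where Z: "is_zero_obj D Z" and ab: "a \<in> Hom D (Dom D f) Z" "b \<in> Hom D Z (Cod D f)"
    and f: "f = b \<cdot>\<^bsub>D\<^esub> a"
    using assms by (rule D.is_zero_arrE)
  have "is_zero_arr E (\<phi> b \<cdot>\<^bsub>E\<^esub> \<phi> a)"
    using ab by (intro E.is_zero_arr_through[OF is_zero_obj_transfer[OF Z]]) (auto simp: mem_Hom_iff)
  moreover have "\<phi> f = \<phi> b \<cdot>\<^bsub>E\<^esub> \<phi> a"
    by (subst f, rule \<phi>_comp) (use ab in \<open>auto simp: mem_Hom_iff\<close>)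
  ultimately show ?thesis
    by simp
qed

lemma factors_transfer:
  assumes "factors D m n" "m \<in> Arr D" "n \<in> Arr D"
  shows "factors E (\<phi> m) (\<phi> n)"
proof -
  obtain u where u: "u \<in> Arr D" "Dom D u = Dom D m" "Cod D u = Dom D n" "n \<cdot>\<^bsub>D\<^esub> u = m"
    using assms(1) unfolding factors_def by blast
  then show ?thesis
    unfolding factors_def using \<phi>_comp[of u n] assms by (intro bexI[of _ "\<phi> u"]) auto
qed

lemma is_mono_transfer:
  assumes "is_mono D m"
  shows "is_mono E (\<phi> m)"
  unfolding is_mono_def
proof (intro conjI ballI impI)
  have m: "m \<in> Arr D"
    using assms by (rule D.is_mono_arr)
  then show "\<phi> m \<in> Arr E"
    by simp
  fix g h
  assume gh: "g \<in> Arr E" "h \<in> Arr E" "Cod E g = Dom E (\<phi> m) \<and> Cod E h = Dom E (\<phi> m) \<and>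
    Dom E g = Dom E h \<and> \<phi> m \<cdot>\<^bsub>E\<^esub> g = \<phi> m \<cdot>\<^bsub>E\<^esub> h"
  have "\<phi> (m \<cdot>\<^bsub>D\<^esub> \<psi> g) = \<phi> (m \<cdot>\<^bsub>D\<^esub> \<psi> h)"
    using gh m by (simp add: \<phi>_comp)
  then have eq: "m \<cdot>\<^bsub>D\<^esub> \<psi> g = m \<cdot>\<^bsub>D\<^esub> \<psi> h"
    using gh m by (subst (asm) \<phi>_eq_iff) auto
  have "\<psi> g = \<psi> h"
    by (rule D.is_mono_cancel[OF assms]) (use gh m eq in auto)
  then show "g = h"
    using gh by (metis \<psi>_simps(2))
qed

text \<open>A test arrow in E is pulled back by \<psi>, lifted in D, and its lift is pushed forward
  by \<phi>. The symmetric isomorphism then yields the converse implication.\<close>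

lemma is_kernel_transfer:
  assumes "is_kernel D k f"
  shows "is_kernel E (\<phi> k) (\<phi> f)"
proof (rule E.is_kernelI)
  note k = D.is_kernelD[OF assms]
  show "\<phi> f \<in> Arr E" "Cod E (\<phi> k) = Dom E (\<phi> f)"
    using k by auto
  show "is_mono E (\<phi> k)"
    using assms by (intro is_mono_transfer D.is_kernel_mono)
  show "is_zero_arr E (\<phi> f \<cdot>\<^bsub>E\<^esub> \<phi> k)"
    using is_zero_arr_transfer[OF k(4)] k by (simp add: \<phi>_comp)
  fix h assume h: "h \<in> Arr E" "Cod E h = Dom E (\<phi> f)" "is_zero_arr E (\<phi> f \<cdot>\<^bsub>E\<^esub> h)"
  have "is_zero_arr D (f \<cdot>\<^bsub>D\<^esub> \<psi> h)"
    using cat_iso.is_zero_arr_transfer[OF cat_iso_sym h(3)] h k by (simp add: \<psi>_comp)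
  then have "factors D (\<psi> h) k"
    using h k by (intro D.is_kernel_factors[OF assms]) auto
  then have "factors E h (\<phi> k)"
    using factors_transfer[of "\<psi> h" k] h k by simp
  then show "\<exists>u\<in>Arr E. Dom E u = Dom E h \<and> Cod E u = Dom E (\<phi> k) \<and> \<phi> k \<cdot>\<^bsub>E\<^esub> u = h"
    by (simp add: factors_def)
qed

lemma is_mono_iff: "m \<in> Arr D \<Longrightarrow> is_mono E (\<phi> m) \<longleftrightarrow> is_mono D m"
  using is_mono_transfer[of m] cat_iso.is_mono_transfer[OF cat_iso_sym, of "\<phi> m"] by auto

lemma is_kernel_iff:
  "k \<in> Arr D \<Longrightarrow> f \<in> Arr D \<Longrightarrow> is_kernel E (\<phi> k) (\<phi> f) \<longleftrightarrow> is_kernel D k f"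
  using is_kernel_transfer[of k f] cat_iso.is_kernel_transfer[OF cat_iso_sym, of "\<phi> k" "\<phi> f"]
  by auto

lemma factors_iff:
  "m \<in> Arr D \<Longrightarrow> n \<in> Arr D \<Longrightarrow> factors E (\<phi> m) (\<phi> n) \<longleftrightarrow> factors D m n"
  using factors_transfer[of m n] cat_iso.factors_transfer[OF cat_iso_sym, of "\<phi> m" "\<phi> n"]
  by auto

end

section \<open>Functor categories\<close>

lemma is_functD:
  assumes "is_funct C D T"
  shows "A \<in> Obj C \<Longrightarrow> FO T A \<in> Obj D" "f \<in> Arr C \<Longrightarrow> FA T f \<in> Arr D"
    "f \<in> Arr C \<Longrightarrow> Dom D (FA T f) = FO T (Dom C f)"
    "f \<in> Arr C \<Longrightarrow> Cod D (FA T f) = FO T (Cod C f)"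
    "A \<in> Obj C \<Longrightarrow> FA T (Ide C A) = Ide D (FO T A)"
  using assms by (auto simp: is_funct_def)

lemma is_functI:
  assumes "FO T \<in> extensional (Obj C)" "FA T \<in> extensional (Arr C)"
    "\<And>A. A \<in> Obj C \<Longrightarrow> FO T A \<in> Obj D" "\<And>f. f \<in> Arr C \<Longrightarrow> FA T f \<in> Arr D"
    "\<And>f. f \<in> Arr C \<Longrightarrow> Dom D (FA T f) = FO T (Dom C f)"
    "\<And>f. f \<in> Arr C \<Longrightarrow> Cod D (FA T f) = FO T (Cod C f)"
    "\<And>A. A \<in> Obj C \<Longrightarrow> FA T (Ide C A) = Ide D (FO T A)"
    "\<And>f g. f \<in> Arr C \<Longrightarrow> g \<in> Arr C \<Longrightarrow> Cod C f = Dom C g \<Longrightarrow>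
      FA T (g \<cdot>\<^bsub>C\<^esub> f) = FA T g \<cdot>\<^bsub>D\<^esub> FA T f"
  shows "is_funct C D T"
  using assms by (auto simp: is_funct_def PiE_def)

lemma is_funct_comp:
  "is_funct C D T \<Longrightarrow> f \<in> Arr C \<Longrightarrow> g \<in> Arr C \<Longrightarrow> Cod C f = Dom C g \<Longrightarrow>
    FA T (g \<cdot>\<^bsub>C\<^esub> f) = FA T g \<cdot>\<^bsub>D\<^esub> FA T f"
  by (simp add: is_funct_def)

lemma is_nattransD:
  assumes "is_nattrans C D t"
  shows "is_funct C D (NDom t)" "is_funct C D (NCod t)"
    "A \<in> Obj C \<Longrightarrow> NComp t A \<in> Arr D"
    "A \<in> Obj C \<Longrightarrow> Dom D (NComp t A) = FO (NDom t) A"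
    "A \<in> Obj C \<Longrightarrow> Cod D (NComp t A) = FO (NCod t) A"
  using assms by (auto simp: is_nattrans_def mem_Hom_iff)

lemma naturality:
  "is_nattrans C D t \<Longrightarrow> f \<in> Arr C \<Longrightarrow>
    NComp t (Cod C f) \<cdot>\<^bsub>D\<^esub> FA (NDom t) f = FA (NCod t) f \<cdot>\<^bsub>D\<^esub> NComp t (Dom C f)"
  by (simp add: is_nattrans_def)

lemma nattrans_eqI:
  fixes s t :: "('o, 'a, 'p, 'b) nattrans"
  assumes "is_nattrans C D s" "is_nattrans C D t" "NDom s = NDom t" "NCod s = NCod t"
    "\<And>A. A \<in> Obj C \<Longrightarrow> NComp s A = NComp t A"
  shows "s = t"
proof -
  have "NComp s = NComp t"
    by (rule extensionalityI[of _ "Obj C"]) (use assms in \<open>auto simp: is_nattrans_def\<close>)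
  then show ?thesis
    using assms by simp
qed

lemma funct_eqI:
  fixes S T :: "('o, 'a, 'p, 'b) funct"
  assumes "is_funct C D S" "is_funct C D T" "\<And>A. A \<in> Obj C \<Longrightarrow> FO S A = FO T A"
    "\<And>f. f \<in> Arr C \<Longrightarrow> FA S f = FA T f"
  shows "S = T"
proof -
  have "FO S = FO T"
    by (rule extensionalityI[of _ "Obj C"]) (use assms in \<open>auto simp: is_funct_def PiE_def\<close>)
  moreover have "FA S = FA T"
    by (rule extensionalityI[of _ "Arr C"]) (use assms in \<open>auto simp: is_funct_def PiE_def\<close>)
  ultimately show ?thesis
    by simp
qed

lemma Fun_simps [simp]:
  "Obj (Fun C D) = {T. is_funct C D T}" "Arr (Fun C D) = {t. is_nattrans C D t}"
  "Dom (Fun C D) = NDom" "Cod (Fun C D) = NCod"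
  "NDom (t \<cdot>\<^bsub>Fun C D\<^esub> s) = NDom s" "NCod (t \<cdot>\<^bsub>Fun C D\<^esub> s) = NCod t"
  "A \<in> Obj C \<Longrightarrow> NComp (t \<cdot>\<^bsub>Fun C D\<^esub> s) A = NComp t A \<cdot>\<^bsub>D\<^esub> NComp s A"
  by (simp_all add: Fun_def)

lemma is_funct_op_cat [simp]: "is_funct (op_cat C) (op_cat D) T \<longleftrightarrow> is_funct C D T"
  unfolding is_funct_def by auto

lemma op_nattrans_simps [simp]:
  "NDom (op_nattrans t) = NCod t" "NCod (op_nattrans t) = NDom t"
  "NComp (op_nattrans t) = NComp t"
  by (simp_all add: op_nattrans_def)

lemma op_op_nattrans [simp]: "op_nattrans (op_nattrans t) = (t :: ('o, 'a, 'p, 'b) nattrans)"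
  by (simp add: op_nattrans_def)

lemma is_nattrans_op_cat [simp]:
  "is_nattrans (op_cat C) (op_cat D) (op_nattrans t) \<longleftrightarrow> is_nattrans C D t"
  unfolding is_nattrans_def by (auto simp: mem_Hom_iff)

lemma op_nattrans_comp:
  "op_nattrans (s \<cdot>\<^bsub>Fun C D\<^esub> t) = op_nattrans t \<cdot>\<^bsub>Fun (op_cat C) (op_cat D)\<^esub> op_nattrans s"
  by (simp add: Fun_def op_nattrans_def)

lemma is_nattransI:
  assumes "is_funct C D (NDom t)" "is_funct C D (NCod t)" "NComp t \<in> extensional (Obj C)"
    "\<And>A. A \<in> Obj C \<Longrightarrow> NComp t A \<in> Arr D \<and> Dom D (NComp t A) = FO (NDom t) A \<and>
      Cod D (NComp t A) = FO (NCod t) A"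
    "\<And>f. f \<in> Arr C \<Longrightarrow>
      NComp t (Cod C f) \<cdot>\<^bsub>D\<^esub> FA (NDom t) f = FA (NCod t) f \<cdot>\<^bsub>D\<^esub> NComp t (Dom C f)"
  shows "is_nattrans C D t"
  using assms by (auto simp: is_nattrans_def mem_Hom_iff)

locale functor_category = C: category C + D: abelian_category D
  for C :: "('o, 'a) cat" and D :: "('p, 'b) cat"
begin

lemmas [simp] = is_functD[of C D] is_nattransD[of C D]

lemma functor_category_op: "functor_category (op_cat C) (op_cat D)"
  by (intro functor_category.intro C.category_op_cat D.abelian_category_op_cat)

lemma is_nattrans_comp:
  assumes s: "is_nattrans C D s" and t: "is_nattrans C D t" and st: "NCod s = NDom t"
  shows "is_nattrans C D (t \<cdot>\<^bsub>Fun C D\<^esub> s)"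
proof (rule is_nattransI)
  show "NComp (t \<cdot>\<^bsub>Fun C D\<^esub> s) \<in> extensional (Obj C)"
    by (simp add: Fun_def)
  fix f assume f: "f \<in> Arr C"
  let ?A = "Dom C f" and ?B = "Cod C f"
  have "(NComp t ?B \<cdot>\<^bsub>D\<^esub> NComp s ?B) \<cdot>\<^bsub>D\<^esub> FA (NDom s) f
      = NComp t ?B \<cdot>\<^bsub>D\<^esub> (FA (NCod s) f \<cdot>\<^bsub>D\<^esub> NComp s ?A)"
    using s t st f naturality[OF s f] by simp
  also have "\<dots> = (FA (NCod t) f \<cdot>\<^bsub>D\<^esub> NComp t ?A) \<cdot>\<^bsub>D\<^esub> NComp s ?A"
    using s t st f naturality[OF t f] by (simp flip: D.assoc)
  also have "\<dots> = FA (NCod t) f \<cdot>\<^bsub>D\<^esub> (NComp t ?A \<cdot>\<^bsub>D\<^esub> NComp s ?A)"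
    using s t st f by simp
  finally show "NComp (t \<cdot>\<^bsub>Fun C D\<^esub> s) ?B \<cdot>\<^bsub>D\<^esub> FA (NDom (t \<cdot>\<^bsub>Fun C D\<^esub> s)) f =
      FA (NCod (t \<cdot>\<^bsub>Fun C D\<^esub> s)) f \<cdot>\<^bsub>D\<^esub> NComp (t \<cdot>\<^bsub>Fun C D\<^esub> s) ?A"
    using f by simp
qed (use s t st in auto)

lemma category_Fun: "category (Fun C D)"
proof
  fix T assume T: "T \<in> Obj (Fun C D)"
  have "is_nattrans C D \<lparr>NDom = T, NCod = T, NComp = \<lambda>A\<in>Obj C. Ide D (FO T A)\<rparr>"
    by (rule is_nattransI) (use T in auto)
  then show "Ide (Fun C D) T \<in> Hom (Fun C D) T T"
    by (simp add: mem_Hom_iff Fun_def)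
next
  fix s t S T U assume "s \<in> Hom (Fun C D) S T" "t \<in> Hom (Fun C D) T U"
  then show "t \<cdot>\<^bsub>Fun C D\<^esub> s \<in> Hom (Fun C D) S U"
    using is_nattrans_comp[of s t] by (auto simp: mem_Hom_iff)
next
  fix s t u S T U V
  assume "s \<in> Hom (Fun C D) S T" "t \<in> Hom (Fun C D) T U" "u \<in> Hom (Fun C D) U V"
  then have stu: "is_nattrans C D s" "is_nattrans C D t" "is_nattrans C D u"
    "NCod s = NDom t" "NCod t = NDom u"
    by (auto simp: mem_Hom_iff)
  show "u \<cdot>\<^bsub>Fun C D\<^esub> (t \<cdot>\<^bsub>Fun C D\<^esub> s) = (u \<cdot>\<^bsub>Fun C D\<^esub> t) \<cdot>\<^bsub>Fun C D\<^esub> s"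
    by (rule nattrans_eqI[of C D]) (use stu is_nattrans_comp in auto)
next
  fix t assume "t \<in> Arr (Fun C D)"
  then have t: "is_nattrans C D t"
    by simp
  have ide: "is_nattrans C D (Ide (Fun C D) T)" if "is_funct C D T" for T
    by (rule is_nattransI) (use that in \<open>auto simp: Fun_def\<close>)
  have ide_simps: "NDom (Ide (Fun C D) T) = T" "NCod (Ide (Fun C D) T) = T"
    "A \<in> Obj C \<Longrightarrow> NComp (Ide (Fun C D) T) A = Ide D (FO T A)" for T A
    by (simp_all add: Fun_def)
  show "t \<cdot>\<^bsub>Fun C D\<^esub> Ide (Fun C D) (Dom (Fun C D) t) = t"
    by (rule nattrans_eqI[of C D]) (use t ide in \<open>auto intro!: is_nattrans_comp simp: ide_simps\<close>)
  show "Ide (Fun C D) (Cod (Fun C D) t) \<cdot>\<^bsub>Fun C D\<^esub> t = t"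
    by (rule nattrans_eqI[of C D]) (use t ide in \<open>auto intro!: is_nattrans_comp simp: ide_simps\<close>)
qed auto

end

sublocale functor_category \<subseteq> F: category "Fun C D"
  by (rule category_Fun)

context functor_category
begin

text \<open>Reversing the stored source and target turns opposite composition into composition over
  the opposite categories; the components stay as they are. All dual statements on functor
  categories pass through this isomorphism.\<close>

lemma cat_iso_op_nattrans:
  "cat_iso (op_cat (Fun C D)) (Fun (op_cat C) (op_cat D)) op_nattrans op_nattrans"
proof -
  interpret op: functor_category "op_cat C" "op_cat D"
    by (rule functor_category_op)
  have "is_nattrans C D (op_nattrans t)" if "is_nattrans (op_cat C) (op_cat D) t" for t
    using is_nattrans_op_cat[of "op_cat C" "op_cat D" t] that by simp
  then show ?thesis
    by (intro cat_iso.intro F.category_op_cat op.category_Fun cat_iso_axioms.intro)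
       (auto simp: op_nattrans_comp)
qed

section \<open>Zero objects and zero arrows of the functor category\<close>

definition zero_funct :: "'p \<Rightarrow> ('o, 'a, 'p, 'b) funct" where
  "zero_funct Z = \<lparr>FO = \<lambda>A\<in>Obj C. Z, FA = \<lambda>f\<in>Arr C. Ide D Z\<rparr>"

text \<open>Each component into Z exists and is unique; uniqueness also gives naturality, because
  both sides of a naturality square end in Z.\<close>

lemma is_terminal_zero_funct:
  assumes "is_zero_obj D Z"
  shows "is_terminal (Fun C D) (zero_funct Z)"
  unfolding is_terminal_def
proof (intro conjI ballI)
  have Z: "Z \<in> Obj D"
    using assms by (simp add: is_zero_obj_def is_terminal_def)
  have zf: "is_funct C D (zero_funct Z)"
    by (rule is_functI) (use Z in \<open>auto simp: zero_funct_def\<close>)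
  then show "zero_funct Z \<in> Obj (Fun C D)"
    by simp
  fix T assume "T \<in> Obj (Fun C D)"
  then have T: "is_funct C D T"
    by simp
  have "\<exists>a. \<forall>A\<in>Obj C. a A \<in> Arr D \<and> Dom D (a A) = FO T A \<and> Cod D (a A) = Z"
    using T by (intro bchoice ballI) (metis D.zero_obj_arr_to[OF assms] is_functD(1)[of C D])
  then obtain a where a: "\<And>A. A \<in> Obj C \<Longrightarrow> a A \<in> Arr D \<and> Dom D (a A) = FO T A \<and> Cod D (a A) = Z"
    by blast
  define t where "t = \<lparr>NDom = T, NCod = zero_funct Z, NComp = \<lambda>A\<in>Obj C. a A\<rparr>"
  have "is_nattrans C D t"
  proof (rule is_nattransI)
    fix f assume f: "f \<in> Arr C"
    show "NComp t (Cod C f) \<cdot>\<^bsub>D\<^esub> FA (NDom t) f = FA (NCod t) f \<cdot>\<^bsub>D\<^esub> NComp t (Dom C f)"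
      by (rule D.zero_obj_to_unique[OF assms])
         (use f a T Z in \<open>auto simp: t_def zero_funct_def\<close>)
  qed (use a T zf in \<open>auto simp: t_def zero_funct_def\<close>)
  then have th: "t \<in> Hom (Fun C D) T (zero_funct Z)"
    by (simp add: mem_Hom_iff t_def)
  show "\<exists>!t. t \<in> Hom (Fun C D) T (zero_funct Z)"
  proof (rule ex1I[of _ t])
    show "t \<in> Hom (Fun C D) T (zero_funct Z)"
      by (fact th)
    fix s assume s: "s \<in> Hom (Fun C D) T (zero_funct Z)"
    show "s = t"
    proof (rule nattrans_eqI[of C D])
      fix A assume A: "A \<in> Obj C"
      show "NComp s A = NComp t A"
        by (rule D.zero_obj_to_unique[OF assms])
           (use A s th in \<open>auto simp: mem_Hom_iff zero_funct_def\<close>)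
    qed (use s th in \<open>auto simp: mem_Hom_iff\<close>)
  qed
qed

text \<open>Initiality is terminality over the opposite categories, transported back. The constant
  functor is the same record on both sides, since \<open>op_cat\<close> keeps identities.\<close>

lemma is_zero_obj_zero_funct:
  assumes "is_zero_obj D Z"
  shows "is_zero_obj (Fun C D) (zero_funct Z)"
proof -
  interpret op: functor_category "op_cat C" "op_cat D"
    by (rule functor_category_op)
  interpret i: cat_iso "Fun (op_cat C) (op_cat D)" "op_cat (Fun C D)" op_nattrans op_nattrans
    by (rule cat_iso.cat_iso_sym[OF cat_iso_op_nattrans])
  have "op.zero_funct Z = zero_funct Z"
    by (simp add: zero_funct_def op.zero_funct_def)
  then show ?thesis
    using i.is_terminal_transfer op.is_terminal_zero_funct[of Z] is_terminal_zero_funct assms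
    by (simp add: is_zero_obj_def[of "Fun C D"])
qed

lemma ex_zero_arr_Fun:
  assumes "is_funct C D S" "is_funct C D T"
  obtains z where "is_zero_arr (Fun C D) z" "is_nattrans C D z" "NDom z = S" "NCod z = T"
    "\<And>A. A \<in> Obj C \<Longrightarrow> is_zero_arr D (NComp z A)"
proof -
  obtain Z where Z: "is_zero_obj D Z"
    using D.has_zero by blast
  note zf = is_zero_obj_zero_funct[OF Z]
  have FOz: "FO (zero_funct Z) A = Z" if "A \<in> Obj C" for A
    using that by (simp add: zero_funct_def)
  obtain a where a: "is_nattrans C D a" "NDom a = S" "NCod a = zero_funct Z"
    using F.zero_obj_arr_to[OF zf, of S] assms by auto
  obtain b where b: "is_nattrans C D b" "NDom b = zero_funct Z" "NCod b = T"
    using F.zero_obj_arr_from[OF zf, of T] assms by auto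
  have "is_zero_arr (Fun C D) (b \<cdot>\<^bsub>Fun C D\<^esub> a)"
    using a b by (intro F.is_zero_arr_through[OF zf]) auto
  moreover have "is_zero_arr D (NComp (b \<cdot>\<^bsub>Fun C D\<^esub> a) A)" if "A \<in> Obj C" for A
    using a b that FOz by (auto intro!: D.is_zero_arr_through[OF Z])
  ultimately show ?thesis
    using that[of "b \<cdot>\<^bsub>Fun C D\<^esub> a"] a b is_nattrans_comp[of a b] by simp
qed

text \<open>Parallel zero arrows are equal, so t is compared with a reference arrow that is zero
  both globally and in each component: in the functor category for one direction, componentwise for
  the other.\<close>

lemma is_zero_arr_Fun_iff:
  "is_zero_arr (Fun C D) t \<longleftrightarrow>
    is_nattrans C D t \<and> (\<forall>A\<in>Obj C. is_zero_arr D (NComp t A))"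
proof
  assume t: "is_zero_arr (Fun C D) t"
  have nt: "is_nattrans C D t"
    using F.is_zero_arr_arr[OF t] by simp
  obtain z where z: "is_zero_arr (Fun C D) z" "NDom z = NDom t" "NCod z = NCod t"
    "\<And>A. A \<in> Obj C \<Longrightarrow> is_zero_arr D (NComp z A)"
    by (rule ex_zero_arr_Fun[of "NDom t" "NCod t"]) (use nt in auto)
  have "z = t"
    by (rule F.is_zero_arr_unique) (use z t in auto)
  then show "is_nattrans C D t \<and> (\<forall>A\<in>Obj C. is_zero_arr D (NComp t A))"
    using z nt by simp
next
  assume t: "is_nattrans C D t \<and> (\<forall>A\<in>Obj C. is_zero_arr D (NComp t A))"
  obtain z where z: "is_zero_arr (Fun C D) z" "is_nattrans C D z" "NDom z = NDom t"
    "NCod z = NCod t" "\<And>A. A \<in> Obj C \<Longrightarrow> is_zero_arr D (NComp z A)"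
    by (rule ex_zero_arr_Fun[of "NDom t" "NCod t"]) (use t in auto)
  have "z = t"
  proof (rule nattrans_eqI[of C D])
    fix A assume A: "A \<in> Obj C"
    show "NComp z A = NComp t A"
      by (rule D.is_zero_arr_unique) (use A z t in auto)
  qed (use z t in auto)
  then show "is_zero_arr (Fun C D) t"
    using z by simp
qed

section \<open>Pointwise monomorphisms and kernels\<close>

lemma is_mono_Fun_pointwise:
  assumes "is_nattrans C D m" "\<And>A. A \<in> Obj C \<Longrightarrow> is_mono D (NComp m A)"
  shows "is_mono (Fun C D) m"
  unfolding is_mono_def
proof (intro conjI ballI impI)
  show "m \<in> Arr (Fun C D)"
    using assms by simp
  fix g h assume gh: "g \<in> Arr (Fun C D)" "h \<in> Arr (Fun C D)"
    "Cod (Fun C D) g = Dom (Fun C D) m \<and> Cod (Fun C D) h = Dom (Fun C D) m \<and>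
      Dom (Fun C D) g = Dom (Fun C D) h \<and> m \<cdot>\<^bsub>Fun C D\<^esub> g = m \<cdot>\<^bsub>Fun C D\<^esub> h"
  have mgh: "m \<cdot>\<^bsub>Fun C D\<^esub> g = m \<cdot>\<^bsub>Fun C D\<^esub> h"
    using gh(3) by (elim conjE)
  have gh': "is_nattrans C D g" "is_nattrans C D h" "NCod g = NDom m" "NCod h = NDom m"
    "NDom g = NDom h"
    using gh by simp_all
  show "g = h"
  proof (rule nattrans_eqI[of C D])
    fix A assume A: "A \<in> Obj C"
    have eq: "NComp m A \<cdot>\<^bsub>D\<^esub> NComp g A = NComp m A \<cdot>\<^bsub>D\<^esub> NComp h A"
      using arg_cong[OF mgh, of "\<lambda>t. NComp t A"] A by simp
    show "NComp g A = NComp h A"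
      by (rule D.is_mono_cancel[OF assms(2)[OF A]]) (use gh' A eq assms(1) in auto)
  qed (use gh' in auto)
qed

text \<open>Pointwise factorisations through a pointwise monomorphism are automatically natural.\<close>

lemma factors_Fun_pointwise:
  assumes h: "is_nattrans C D h" and k: "is_nattrans C D k" and hk: "NCod h = NCod k"
    and mono: "\<And>A. A \<in> Obj C \<Longrightarrow> is_mono D (NComp k A)"
    and fac: "\<And>A. A \<in> Obj C \<Longrightarrow> factors D (NComp h A) (NComp k A)"
  shows "factors (Fun C D) h k"
proof -
  have "\<exists>u. \<forall>A\<in>Obj C. u A \<in> Arr D \<and> Dom D (u A) = FO (NDom h) A \<and>
    Cod D (u A) = FO (NDom k) A \<and> NComp k A \<cdot>\<^bsub>D\<^esub> u A = NComp h A"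
  proof (intro bchoice ballI)
    fix A assume A: "A \<in> Obj C"
    then show "\<exists>u. u \<in> Arr D \<and> Dom D u = FO (NDom h) A \<and> Cod D u = FO (NDom k) A \<and>
      NComp k A \<cdot>\<^bsub>D\<^esub> u = NComp h A"
      using fac[OF A] h k unfolding factors_def by auto
  qed
  then obtain u where u: "\<And>A. A \<in> Obj C \<Longrightarrow> u A \<in> Arr D" "\<And>A. A \<in> Obj C \<Longrightarrow> Dom D (u A) = FO (NDom h) A"
    "\<And>A. A \<in> Obj C \<Longrightarrow> Cod D (u A) = FO (NDom k) A"
    "\<And>A. A \<in> Obj C \<Longrightarrow> NComp k A \<cdot>\<^bsub>D\<^esub> u A = NComp h A"
    by metis
  define t where "t = \<lparr>NDom = NDom h, NCod = NDom k, NComp = \<lambda>A\<in>Obj C. u A\<rparr>"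
  have t: "is_nattrans C D t"
  proof (rule is_nattransI)
    fix f assume f: "f \<in> Arr C"
    let ?A = "Dom C f" and ?B = "Cod C f"
    have AB: "?A \<in> Obj C" "?B \<in> Obj C"
      using f by auto
    have "NComp k ?B \<cdot>\<^bsub>D\<^esub> (u ?B \<cdot>\<^bsub>D\<^esub> FA (NDom h) f) = (NComp k ?B \<cdot>\<^bsub>D\<^esub> u ?B) \<cdot>\<^bsub>D\<^esub> FA (NDom h) f"
      by (rule D.assoc[symmetric]) (use h k f u AB in auto)
    also have "\<dots> = FA (NCod k) f \<cdot>\<^bsub>D\<^esub> (NComp k ?A \<cdot>\<^bsub>D\<^esub> u ?A)"
      using naturality[OF h f] u AB hk by simp
    also have "\<dots> = (FA (NCod k) f \<cdot>\<^bsub>D\<^esub> NComp k ?A) \<cdot>\<^bsub>D\<^esub> u ?A"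
      by (rule D.assoc[symmetric]) (use h k f u AB in auto)
    also have "\<dots> = (NComp k ?B \<cdot>\<^bsub>D\<^esub> FA (NDom k) f) \<cdot>\<^bsub>D\<^esub> u ?A"
      using naturality[OF k f] by simp
    also have "\<dots> = NComp k ?B \<cdot>\<^bsub>D\<^esub> (FA (NDom k) f \<cdot>\<^bsub>D\<^esub> u ?A)"
      by (rule D.assoc) (use h k f u AB in auto)
    finally have eq: "NComp k ?B \<cdot>\<^bsub>D\<^esub> (u ?B \<cdot>\<^bsub>D\<^esub> FA (NDom h) f) =
      NComp k ?B \<cdot>\<^bsub>D\<^esub> (FA (NDom k) f \<cdot>\<^bsub>D\<^esub> u ?A)" .
    have "u ?B \<cdot>\<^bsub>D\<^esub> FA (NDom h) f = FA (NDom k) f \<cdot>\<^bsub>D\<^esub> u ?A"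
      by (rule D.is_mono_cancel[OF mono[OF AB(2)]]) (use eq h k f u AB in auto)
    then show "NComp t ?B \<cdot>\<^bsub>D\<^esub> FA (NDom t) f = FA (NCod t) f \<cdot>\<^bsub>D\<^esub> NComp t ?A"
      using AB by (simp add: t_def)
  qed (use u h k in \<open>auto simp: t_def\<close>)
  have "k \<cdot>\<^bsub>Fun C D\<^esub> t = h"
    by (rule nattrans_eqI[of C D])
       (use t h k hk u in \<open>auto intro!: is_nattrans_comp simp: t_def\<close>)
  then show ?thesis
    unfolding factors_def using t by (intro bexI[of _ t]) (auto simp: t_def)
qed

lemma is_kernel_Fun_pointwise:
  assumes k: "is_nattrans C D k" and f: "is_nattrans C D f" and kf: "NCod k = NDom f"
    and ker: "\<And>A. A \<in> Obj C \<Longrightarrow> is_kernel D (NComp k A) (NComp f A)"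
  shows "is_kernel (Fun C D) k f"
proof (rule F.is_kernelI)
  have mono: "is_mono D (NComp k A)" if "A \<in> Obj C" for A
    using ker[OF that] by (rule D.is_kernel_mono)
  show "f \<in> Arr (Fun C D)" "Cod (Fun C D) k = Dom (Fun C D) f"
    using f kf by auto
  show "is_mono (Fun C D) k"
    using k mono by (rule is_mono_Fun_pointwise)
  show "is_zero_arr (Fun C D) (f \<cdot>\<^bsub>Fun C D\<^esub> k)"
    using k f kf D.is_kernelD(4)[OF ker] by (auto simp: is_zero_arr_Fun_iff intro!: is_nattrans_comp)
  fix h assume h: "h \<in> Arr (Fun C D)" "Cod (Fun C D) h = Dom (Fun C D) f"
    "is_zero_arr (Fun C D) (f \<cdot>\<^bsub>Fun C D\<^esub> h)"
  have "factors (Fun C D) h k"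
  proof (rule factors_Fun_pointwise)
    fix A assume A: "A \<in> Obj C"
    show "factors D (NComp h A) (NComp k A)"
      by (rule D.is_kernel_factors[OF ker[OF A]])
         (use h f A in \<open>auto simp: is_zero_arr_Fun_iff\<close>)
  qed (use h k kf mono in auto)
  then show "\<exists>u\<in>Arr (Fun C D). Dom (Fun C D) u = Dom (Fun C D) h \<and>
      Cod (Fun C D) u = Dom (Fun C D) k \<and> k \<cdot>\<^bsub>Fun C D\<^esub> u = h"
    by (simp add: factors_def)
qed

text \<open>Kernels of the components are chosen independently of each other. That they form a
  functor and a natural transformation follows from the universal property.\<close>

lemma ex_pointwise_kernel:
  assumes f: "is_nattrans C D f"
  obtains k where "is_nattrans C D k" "NCod k = NDom f"
    "\<And>A. A \<in> Obj C \<Longrightarrow> is_kernel D (NComp k A) (NComp f A)"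
proof -
  let ?T = "NDom f" and ?S = "NCod f"
  have "\<exists>\<kappa>. \<forall>A\<in>Obj C. is_kernel D (\<kappa> A) (NComp f A)"
    using f by (intro bchoice ballI D.has_kernels) simp
  then obtain \<kappa> where \<kappa>: "\<And>A. A \<in> Obj C \<Longrightarrow> is_kernel D (\<kappa> A) (NComp f A)"
    by blast
  have \<kappa>_simps: "\<kappa> A \<in> Arr D" "Cod D (\<kappa> A) = FO ?T A" if "A \<in> Obj C" for A
    using D.is_kernelD[OF \<kappa>[OF that]] f that by auto
  \<comment> \<open>The action on arrows: by naturality of f, the image of \<phi> restricted to the
    kernel at the source is killed by f at the target, so it lifts through the kernel there. The
    equation for U is later the naturality of the inclusion.\<close>
  have "\<exists>U. \<forall>\<phi>\<in>Arr C. U \<phi> \<in> Arr D \<and> Dom D (U \<phi>) = Dom D (\<kappa> (Dom C \<phi>)) \<and>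
    Cod D (U \<phi>) = Dom D (\<kappa> (Cod C \<phi>)) \<and> \<kappa> (Cod C \<phi>) \<cdot>\<^bsub>D\<^esub> U \<phi> = FA ?T \<phi> \<cdot>\<^bsub>D\<^esub> \<kappa> (Dom C \<phi>)"
  proof (intro bchoice ballI)
    fix \<phi> assume \<phi>: "\<phi> \<in> Arr C"
    let ?A = "Dom C \<phi>" and ?B = "Cod C \<phi>"
    have AB: "?A \<in> Obj C" "?B \<in> Obj C"
      using \<phi> by auto
    have "NComp f ?B \<cdot>\<^bsub>D\<^esub> (FA ?T \<phi> \<cdot>\<^bsub>D\<^esub> \<kappa> ?A) = FA ?S \<phi> \<cdot>\<^bsub>D\<^esub> (NComp f ?A \<cdot>\<^bsub>D\<^esub> \<kappa> ?A)"
      by (rule D.comp_eq_extend[OF naturality[OF f \<phi>]]) (use f \<phi> AB \<kappa>_simps in auto)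
    moreover have "is_zero_arr D (FA ?S \<phi> \<cdot>\<^bsub>D\<^esub> (NComp f ?A \<cdot>\<^bsub>D\<^esub> \<kappa> ?A))"
      by (rule D.is_zero_arr_comp_left[OF D.is_kernelD(4)[OF \<kappa>[OF AB(1)]]])
         (use f \<phi> AB \<kappa>_simps in auto)
    ultimately have "factors D (FA ?T \<phi> \<cdot>\<^bsub>D\<^esub> \<kappa> ?A) (\<kappa> ?B)"
      by (intro D.is_kernel_factors[OF \<kappa>[OF AB(2)]]) (use f \<phi> AB \<kappa>_simps in auto)
    then show "\<exists>u. u \<in> Arr D \<and> Dom D u = Dom D (\<kappa> ?A) \<and> Cod D u = Dom D (\<kappa> ?B) \<and>
      \<kappa> ?B \<cdot>\<^bsub>D\<^esub> u = FA ?T \<phi> \<cdot>\<^bsub>D\<^esub> \<kappa> ?A"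
      unfolding factors_def using f \<phi> AB \<kappa>_simps by auto
  qed
  then obtain U where U: "\<And>\<phi>. \<phi> \<in> Arr C \<Longrightarrow> U \<phi> \<in> Arr D"
    "\<And>\<phi>. \<phi> \<in> Arr C \<Longrightarrow> Dom D (U \<phi>) = Dom D (\<kappa> (Dom C \<phi>))"
    "\<And>\<phi>. \<phi> \<in> Arr C \<Longrightarrow> Cod D (U \<phi>) = Dom D (\<kappa> (Cod C \<phi>))"
    "\<And>\<phi>. \<phi> \<in> Arr C \<Longrightarrow> \<kappa> (Cod C \<phi>) \<cdot>\<^bsub>D\<^esub> U \<phi> = FA ?T \<phi> \<cdot>\<^bsub>D\<^esub> \<kappa> (Dom C \<phi>)"
    by metis
  define K where "K = \<lparr>FO = \<lambda>A\<in>Obj C. Dom D (\<kappa> A), FA = \<lambda>\<phi>\<in>Arr C. U \<phi>\<rparr>"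
  \<comment> \<open>The lifts were chosen arrow by arrow. Identities and composites are preserved
    because both sides agree after composing with the mono \<kappa>.\<close>
  have UI: "U (Ide C A) = Ide D (Dom D (\<kappa> A))" if A: "A \<in> Obj C" for A
    by (rule D.is_mono_cancel[OF D.is_kernel_mono[OF \<kappa>[OF A]]])
       (use A U[of "Ide C A"] \<kappa>_simps[OF A] f D.comp_ide_left[of "\<kappa> A"] in auto)
  have UC: "U (\<psi> \<cdot>\<^bsub>C\<^esub> \<phi>) = U \<psi> \<cdot>\<^bsub>D\<^esub> U \<phi>"
    if p: "\<phi> \<in> Arr C" "\<psi> \<in> Arr C" "Cod C \<phi> = Dom C \<psi>" for \<phi> \<psi>
  proof -
    let ?A = "Dom C \<phi>" and ?B = "Dom C \<psi>" and ?E = "Cod C \<psi>"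
    have o: "?A \<in> Obj C" "?B \<in> Obj C" "?E \<in> Obj C"
      using p by auto
    have pp: "\<psi> \<cdot>\<^bsub>C\<^esub> \<phi> \<in> Arr C" "Dom C (\<psi> \<cdot>\<^bsub>C\<^esub> \<phi>) = ?A" "Cod C (\<psi> \<cdot>\<^bsub>C\<^esub> \<phi>) = ?E"
      using p by auto
    have "\<kappa> ?E \<cdot>\<^bsub>D\<^esub> (U \<psi> \<cdot>\<^bsub>D\<^esub> U \<phi>) = FA ?T \<psi> \<cdot>\<^bsub>D\<^esub> (\<kappa> ?B \<cdot>\<^bsub>D\<^esub> U \<phi>)"
      by (rule D.comp_eq_extend[OF U(4)[OF p(2)]]) (use f p o \<kappa>_simps U in auto)
    also have "\<dots> = FA ?T \<psi> \<cdot>\<^bsub>D\<^esub> (FA ?T \<phi> \<cdot>\<^bsub>D\<^esub> \<kappa> ?A)"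
      using U(4)[OF p(1)] p(3) by simp
    also have "\<dots> = (FA ?T \<psi> \<cdot>\<^bsub>D\<^esub> FA ?T \<phi>) \<cdot>\<^bsub>D\<^esub> \<kappa> ?A"
      by (rule D.assoc[symmetric]) (use f p o \<kappa>_simps U in auto)
    also have "\<dots> = \<kappa> ?E \<cdot>\<^bsub>D\<^esub> U (\<psi> \<cdot>\<^bsub>C\<^esub> \<phi>)"
      using U(4)[OF pp(1)] is_funct_comp[OF is_nattransD(1)[OF f] p] pp by simp
    finally have eq: "\<kappa> ?E \<cdot>\<^bsub>D\<^esub> U (\<psi> \<cdot>\<^bsub>C\<^esub> \<phi>) = \<kappa> ?E \<cdot>\<^bsub>D\<^esub> (U \<psi> \<cdot>\<^bsub>D\<^esub> U \<phi>)"
      by simp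
    show ?thesis
      by (rule D.is_mono_cancel[OF D.is_kernel_mono[OF \<kappa>[OF o(3)]]]) (use eq p pp o U in auto)
  qed
  have K: "is_funct C D K"
    by (rule is_functI) (use U UI UC \<kappa>_simps in \<open>auto simp: K_def\<close>)
  define k where "k = \<lparr>NDom = K, NCod = ?T, NComp = \<lambda>A\<in>Obj C. \<kappa> A\<rparr>"
  have "is_nattrans C D k"
    by (rule is_nattransI) (use K f \<kappa>_simps U in \<open>auto simp: k_def K_def\<close>)
  then show ?thesis
    using that[of k] \<kappa> by (simp add: k_def)
qed

text \<open>A mono has zero kernel, and the kernel can be taken pointwise; each component then kills
  only zero arrows, which in an abelian category makes it mono.\<close>

lemma is_mono_Fun_iff:
  "is_mono (Fun C D) m \<longleftrightarrow> is_nattrans C D m \<and> (\<forall>A\<in>Obj C. is_mono D (NComp m A))"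
proof
  assume m: "is_mono (Fun C D) m"
  have nm: "is_nattrans C D m"
    using F.is_mono_arr[OF m] by simp
  obtain k where k: "is_nattrans C D k" "NCod k = NDom m"
    "\<And>A. A \<in> Obj C \<Longrightarrow> is_kernel D (NComp k A) (NComp m A)"
    using ex_pointwise_kernel[OF nm] by blast
  have ker: "is_kernel (Fun C D) k m"
    using k nm by (intro is_kernel_Fun_pointwise) auto
  \<comment> \<open>A zero arrow parallel to k. After m both become zero arrows, hence equal, and
    cancelling m shows that k itself is zero.\<close>
  obtain z where z: "is_zero_arr (Fun C D) z" and nz: "is_nattrans C D z"
    and zk: "NDom z = NDom k" "NCod z = NCod k"
    by (rule ex_zero_arr_Fun[of "NDom k" "NCod k"]) (use k nm in auto)
  have "is_zero_arr (Fun C D) (m \<cdot>\<^bsub>Fun C D\<^esub> z)"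
    by (rule F.is_zero_arr_comp_left[OF z]) (use nm k zk in auto)
  then have eq: "m \<cdot>\<^bsub>Fun C D\<^esub> k = m \<cdot>\<^bsub>Fun C D\<^esub> z"
    by (rule F.is_zero_arr_unique[OF F.is_kernelD(4)[OF ker]]) (use k nm z zk zk in auto)
  have "k = z"
    by (rule F.is_mono_cancel[OF m]) (use eq k nz zk in auto)
  then have kz: "is_zero_arr D (NComp k A)" if "A \<in> Obj C" for A
    using z that by (simp add: is_zero_arr_Fun_iff)
  have "is_mono D (NComp m A)" if A: "A \<in> Obj C" for A
  proof (rule D.is_monoI_zero)
    show "NComp m A \<in> Arr D"
      using nm A by simp
    fix g assume g: "g \<in> Arr D" "Cod D g = Dom D (NComp m A)" "is_zero_arr D (NComp m A \<cdot>\<^bsub>D\<^esub> g)"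
    obtain u where u: "u \<in> Arr D" "Cod D u = Dom D (NComp k A)" "NComp k A \<cdot>\<^bsub>D\<^esub> u = g"
      using D.is_kernel_lift[OF k(3)[OF A] g] by blast
    show "is_zero_arr D g"
      using D.is_zero_arr_comp_right[OF kz[OF A] u(1,2)] u(3) by simp
  qed
  then show "is_nattrans C D m \<and> (\<forall>A\<in>Obj C. is_mono D (NComp m A))"
    using nm by blast
qed (simp add: is_mono_Fun_pointwise)

lemma factors_Fun_D:
  assumes "factors (Fun C D) h k" "A \<in> Obj C" "is_nattrans C D h" "is_nattrans C D k"
  shows "factors D (NComp h A) (NComp k A)"
proof -
  obtain u where u: "is_nattrans C D u" "NDom u = NDom h" "NCod u = NDom k" "k \<cdot>\<^bsub>Fun C D\<^esub> u = h"
    using assms(1) unfolding factors_def by auto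
  then have "NComp k A \<cdot>\<^bsub>D\<^esub> NComp u A = NComp h A"
    using assms(2) by auto
  then show ?thesis
    unfolding factors_def using u assms by (intro bexI[of _ "NComp u A"]) auto
qed

text \<open>Any kernel is equivalent under \<open>factors\<close> to the one built pointwise, and
  such factorisations restrict to every component.\<close>

lemma is_kernel_Fun_iff:
  "is_kernel (Fun C D) k f \<longleftrightarrow> is_nattrans C D k \<and> is_nattrans C D f \<and> NCod k = NDom f \<and>
    (\<forall>A\<in>Obj C. is_kernel D (NComp k A) (NComp f A))"
proof
  assume k: "is_kernel (Fun C D) k f"
  have nk: "is_nattrans C D k" "is_nattrans C D f" "NCod k = NDom f"
    using F.is_kernelD[OF k] by auto
  obtain l where l: "is_nattrans C D l" "NCod l = NDom f"
    "\<And>A. A \<in> Obj C \<Longrightarrow> is_kernel D (NComp l A) (NComp f A)"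
    using ex_pointwise_kernel[OF nk(2)] by blast
  have ker: "is_kernel (Fun C D) l f"
    using l nk by (intro is_kernel_Fun_pointwise) auto
  have "factors (Fun C D) k l"
    by (rule F.is_kernel_factors[OF ker]) (use F.is_kernelD[OF k] in auto)
  moreover have "factors (Fun C D) l k"
    by (rule F.is_kernel_factors[OF k]) (use F.is_kernelD[OF ker] in auto)
  ultimately have "is_kernel D (NComp k A) (NComp f A)" if A: "A \<in> Obj C" for A
    using D.is_kernel_cong[OF l(3)[OF A], of "NComp k A"] F.is_kernel_mono[OF k] factors_Fun_D A nk l
    by (auto simp: is_mono_Fun_iff)
  then show "is_nattrans C D k \<and> is_nattrans C D f \<and> NCod k = NDom f \<and>
    (\<forall>A\<in>Obj C. is_kernel D (NComp k A) (NComp f A))"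
    using nk by blast
qed (simp add: is_kernel_Fun_pointwise)

section \<open>Cokernels, and normality of the functor category\<close>

lemma is_epi_Fun_iff:
  assumes "is_nattrans C D e"
  shows "is_epi (Fun C D) e \<longleftrightarrow> is_mono (Fun (op_cat C) (op_cat D)) (op_nattrans e)"
  using cat_iso.is_mono_iff[OF cat_iso_op_nattrans, of e] assms by (simp add: is_epi_def)

lemma is_cokernel_Fun_iff:
  assumes "is_nattrans C D q" "is_nattrans C D f"
  shows "is_cokernel (Fun C D) q f \<longleftrightarrow>
    is_kernel (Fun (op_cat C) (op_cat D)) (op_nattrans q) (op_nattrans f)"
  using cat_iso.is_kernel_iff[OF cat_iso_op_nattrans, of q f] assms by (simp add: is_cokernel_def)

lemma is_cokernelD:
  assumes "is_cokernel (Fun C D) q f"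
  shows "is_nattrans C D q" "is_nattrans C D f" "NDom q = NCod f"
  using category.is_kernelD[OF F.category_op_cat assms[unfolded is_cokernel_def]] by auto

lemma is_cokernel_Fun_pointwise_iff:
  "is_cokernel (Fun C D) q f \<longleftrightarrow> is_nattrans C D q \<and> is_nattrans C D f \<and> NDom q = NCod f \<and>
    (\<forall>A\<in>Obj C. is_cokernel D (NComp q A) (NComp f A))"
proof -
  interpret op: functor_category "op_cat C" "op_cat D"
    by (rule functor_category_op)
  show ?thesis
  proof
    assume q: "is_cokernel (Fun C D) q f"
    note d = is_cokernelD[OF q]
    have "is_kernel (Fun (op_cat C) (op_cat D)) (op_nattrans q) (op_nattrans f)"
      using is_cokernel_Fun_iff[OF d(1,2)] q by (rule iffD1)
    then show "is_nattrans C D q \<and> is_nattrans C D f \<and> NDom q = NCod f \<and>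
        (\<forall>A\<in>Obj C. is_cokernel D (NComp q A) (NComp f A))"
      unfolding op.is_kernel_Fun_iff is_cokernel_def by simp
  next
    assume a: "is_nattrans C D q \<and> is_nattrans C D f \<and> NDom q = NCod f \<and>
      (\<forall>A\<in>Obj C. is_cokernel D (NComp q A) (NComp f A))"
    then have "is_kernel (Fun (op_cat C) (op_cat D)) (op_nattrans q) (op_nattrans f)"
      unfolding op.is_kernel_Fun_iff is_cokernel_def by simp
    then show "is_cokernel (Fun C D) q f"
      using is_cokernel_Fun_iff[of q f] a by blast
  qed
qed

lemma ex_kernel_Fun: "is_nattrans C D f \<Longrightarrow> \<exists>k. is_kernel (Fun C D) k f"
  using ex_pointwise_kernel is_kernel_Fun_pointwise by metis

lemma ex_cokernel_Fun:
  assumes "is_nattrans C D f"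
  shows "\<exists>q. is_cokernel (Fun C D) q f"
proof -
  interpret op: functor_category "op_cat C" "op_cat D"
    by (rule functor_category_op)
  obtain k where k: "is_kernel (Fun (op_cat C) (op_cat D)) k (op_nattrans f)"
    using op.ex_kernel_Fun[of "op_nattrans f"] assms by auto
  then have "is_nattrans C D (op_nattrans k)"
    using is_nattrans_op_cat[of "op_cat C" "op_cat D" k] op.F.is_kernelD(2)[OF k] by simp
  then show ?thesis
    using is_cokernel_Fun_iff[of "op_nattrans k" f] k assms by auto
qed

text \<open>The cokernel of m is pointwise, and each component of m is the kernel of that component;
  pointwise kernels are kernels.\<close>

lemma mono_Fun_is_kernel:
  assumes "is_mono (Fun C D) m"
  shows "\<exists>f. is_kernel (Fun C D) m f"
proof -
  have m: "is_nattrans C D m" "\<And>A. A \<in> Obj C \<Longrightarrow> is_mono D (NComp m A)"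
    using assms by (auto simp: is_mono_Fun_iff)
  obtain q where q: "is_cokernel (Fun C D) q m"
    using ex_cokernel_Fun[OF m(1)] by blast
  then have "is_kernel (Fun C D) m q"
    using m D.mono_is_kernel by (auto simp: is_kernel_Fun_iff is_cokernel_Fun_pointwise_iff)
  then show ?thesis
    by blast
qed

lemma normal_category_Fun: "normal_category (Fun C D)"
proof
  interpret op: functor_category "op_cat C" "op_cat D"
    by (rule functor_category_op)
  show "\<exists>Z. is_zero_obj (Fun C D) Z"
    using is_zero_obj_zero_funct D.has_zero by blast
  \<comment> \<open>An epi becomes a mono over the opposite categories, where the mono case applies;
    the arrow found there is turned back with \<open>op_nattrans\<close>.\<close>
  show "\<exists>f. is_cokernel (Fun C D) e f" if epi: "is_epi (Fun C D) e" for e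
  proof -
    have e: "is_nattrans C D e"
      using epi category.is_mono_arr[OF F.category_op_cat] by (fastforce simp: is_epi_def)
    then obtain f where f: "is_kernel (Fun (op_cat C) (op_cat D)) (op_nattrans e) f"
      using op.mono_Fun_is_kernel is_epi_Fun_iff epi by blast
    then have "is_nattrans C D (op_nattrans f)"
      using is_nattrans_op_cat[of "op_cat C" "op_cat D" f] op.F.is_kernelD(1)[OF f] by simp
    then show ?thesis
      using is_cokernel_Fun_iff[of e "op_nattrans f"] e f by auto
  qed
qed (auto simp: ex_kernel_Fun ex_cokernel_Fun mono_Fun_is_kernel)

end

sublocale functor_category \<subseteq> F: normal_category "Fun C D"
  by (rule normal_category_Fun)

section \<open>Preradicals\<close>

lemma id_funct_simps [simp]:
  "A \<in> Obj C \<Longrightarrow> FO (id_funct C) A = A" "f \<in> Arr C \<Longrightarrow> FA (id_funct C) f = f"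
  by (simp_all add: id_funct_def)

lemma comp_funct_simps [simp]:
  "A \<in> Obj C \<Longrightarrow> FO (comp_funct C T S) A = FO T (FO S A)"
  "f \<in> Arr C \<Longrightarrow> FA (comp_funct C T S) f = FA T (FA S f)"
  by (simp_all add: comp_funct_def)

lemma whisker_simps [simp]:
  "NDom (whisker C t S) = comp_funct C (NDom t) S"
  "NCod (whisker C t S) = comp_funct C (NCod t) S"
  "A \<in> Obj C \<Longrightarrow> NComp (whisker C t S) A = NComp t (FO S A)"
  by (simp_all add: whisker_def)

lemma id_funct_op_cat [simp]: "id_funct (op_cat C) = id_funct C"
  by (simp add: id_funct_def)

lemma whisker_op_cat: "whisker (op_cat C) (op_nattrans t) S = op_nattrans (whisker C t S)"
  by (simp add: whisker_def op_nattrans_def comp_funct_def)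

definition prod_rep ::
  "('o, 'a) cat \<Rightarrow> ('o, 'a, 'o, 'a) nattrans \<Rightarrow> ('o, 'a, 'o, 'a) nattrans \<Rightarrow> ('o, 'a, 'o, 'a) nattrans"
  where "prod_rep C t s = s \<cdot>\<^bsub>Fun C C\<^esub> whisker C t (NDom s)"

text \<open>The pivot of the duality: for cokernels t and s, the right-hand side is the composite
  epi whose kernel represents the coproduct, and the left-hand side is the product of the dual
  preradicals.\<close>

lemma op_nattrans_prod_rep:
  "prod_rep (op_cat C) (op_nattrans t) (op_nattrans s) =
    op_nattrans (whisker C t (NCod s) \<cdot>\<^bsub>Fun C C\<^esub> s)"
  by (simp add: prod_rep_def whisker_op_cat op_nattrans_comp)

locale preradicals = functor_category C C for C :: "('o, 'a) cat"
begin

abbreviation Rad :: "('o, 'a, 'o, 'a) nattrans set" where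
  "Rad \<equiv> monos_into (Fun C C) (id_funct C)"

lemma preradicals_op: "preradicals (op_cat C)"
  by (intro preradicals.intro functor_category_op)

lemma Rad_iff: "t \<in> Rad \<longleftrightarrow> is_mono (Fun C C) t \<and> NCod t = id_funct C"
  by (simp add: monos_into_def)

lemma RadD:
  assumes "t \<in> Rad"
  shows "is_mono (Fun C C) t" "is_nattrans C C t" "NCod t = id_funct C"
    "\<And>A. A \<in> Obj C \<Longrightarrow> is_mono C (NComp t A)"
  using assms by (auto simp: Rad_iff is_mono_Fun_iff)

lemma mem_pr_class:
  assumes "t \<in> Rad"
  shows "n \<in> pr_class C t \<longleftrightarrow> n \<in> Rad \<and> factors (Fun C C) t n \<and> factors (Fun C C) n t"
  using assms unfolding pr_class_def sub_equiv_def factors_def Image_def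
  by (auto simp: mem_Hom_iff)

lemma pr_class_self: "t \<in> Rad \<Longrightarrow> t \<in> pr_class C t"
  using F.factors_refl[of t] RadD(2)[of t] by (simp add: mem_pr_class)

lemma pr_class_eq:
  assumes "s \<in> Rad" "t \<in> Rad" "factors (Fun C C) s t" "factors (Fun C C) t s"
  shows "pr_class C s = pr_class C t"
proof (rule Set.set_eqI)
  fix n
  have arr: "m \<in> Arr (Fun C C)" if "m \<in> Rad" for m
    using RadD(2)[OF that] by simp
  show "n \<in> pr_class C s \<longleftrightarrow> n \<in> pr_class C t"
    unfolding mem_pr_class[OF assms(1)] mem_pr_class[OF assms(2)]
    using F.factors_trans[of _ s t] F.factors_trans[of _ t s] F.factors_trans[of s t n]
      F.factors_trans[of t s n] assms arr by blast
qed

lemma Pr_iff: "X \<in> Pr C \<longleftrightarrow> (\<exists>t\<in>Rad. X = pr_class C t)"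
  by (auto simp: Pr_def quotient_def pr_class_def)

lemma is_funct_id [simp]: "is_funct C C (id_funct C)"
  by (rule is_functI) (auto simp: id_funct_def)

lemma is_funct_comp_funct [simp]:
  assumes "is_funct C C T" "is_funct C C S"
  shows "is_funct C C (comp_funct C T S)"
proof (rule is_functI)
  fix f g assume fg: "f \<in> Arr C" "g \<in> Arr C" "Cod C f = Dom C g"
  show "FA (comp_funct C T S) (g \<cdot>\<^bsub>C\<^esub> f) =
    FA (comp_funct C T S) g \<cdot>\<^bsub>C\<^esub> FA (comp_funct C T S) f"
    using fg assms is_funct_comp[OF assms(2) fg]
      is_funct_comp[OF assms(1), of "FA S f" "FA S g"] by simp
qed (use assms in \<open>auto simp: comp_funct_def\<close>)

text \<open>Extensionality makes this a genuine equality of functors, so whiskering a preradical by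
  S ends at S itself, and whiskering its cokernel by S starts there; the composites in products and
  coproducts thus match.\<close>

lemma comp_funct_id [simp]:
  assumes "is_funct C C S"
  shows "comp_funct C (id_funct C) S = S"
  by (rule funct_eqI[of C C]) (use assms in auto)

lemma is_nattrans_whisker [simp]:
  assumes "is_nattrans C C t" "is_funct C C S"
  shows "is_nattrans C C (whisker C t S)"
proof (rule is_nattransI)
  show "NComp (whisker C t S) \<in> extensional (Obj C)"
    by (simp add: whisker_def)
  fix f assume f: "f \<in> Arr C"
  show "NComp (whisker C t S) (Cod C f) \<cdot>\<^bsub>C\<^esub> FA (NDom (whisker C t S)) f =
    FA (NCod (whisker C t S)) f \<cdot>\<^bsub>C\<^esub> NComp (whisker C t S) (Dom C f)"
    using naturality[OF assms(1), of "FA S f"] f assms by simp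
qed (use assms in auto)

lemma is_kernel_whisker:
  assumes "is_kernel (Fun C C) k f" "is_funct C C S"
  shows "is_kernel (Fun C C) (whisker C k S) (whisker C f S)"
  using assms by (auto simp: is_kernel_Fun_iff)

section \<open>Products of preradicals on representatives\<close>

lemma prod_rep_Rad:
  assumes t: "t \<in> Rad" and s: "s \<in> Rad"
  shows "prod_rep C t s \<in> Rad"
proof -
  have w: "is_mono (Fun C C) (whisker C t (NDom s))"
    using RadD[OF t] RadD[OF s] by (auto simp: is_mono_Fun_iff)
  have "is_mono (Fun C C) (prod_rep C t s)"
    unfolding prod_rep_def
    by (rule F.is_mono_comp[OF w RadD(1)[OF s]]) (use RadD[OF t] RadD[OF s] in auto)
  then show ?thesis
    using RadD(3)[OF s] by (simp add: Rad_iff prod_rep_def)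
qed

text \<open>The target is a pointwise mono, so componentwise factorisations suffice and their
  naturality is automatic.\<close>

lemma prod_rep_factors:
  assumes t: "t \<in> Rad" "t' \<in> Rad" "factors (Fun C C) t t'"
    and s: "s \<in> Rad" "s' \<in> Rad" "factors (Fun C C) s s'"
  shows "factors (Fun C C) (prod_rep C t s) (prod_rep C t' s')"
proof (rule factors_Fun_pointwise)
  note p = RadD[OF prod_rep_Rad[OF t(1) s(1)]] and p' = RadD[OF prod_rep_Rad[OF t(2) s(2)]]
  show "is_nattrans C C (prod_rep C t s)" "is_nattrans C C (prod_rep C t' s')"
    "NCod (prod_rep C t s) = NCod (prod_rep C t' s')"
    using p p' by auto
  fix A assume A: "A \<in> Obj C"
  show "is_mono C (NComp (prod_rep C t' s') A)"
    using p' A by simp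
  note tt = RadD(2)[OF t(1)] RadD(2)[OF t(2)] RadD(3)[OF t(1)] RadD(3)[OF t(2)]
  note ss = RadD(2)[OF s(1)] RadD(2)[OF s(2)] RadD(3)[OF s(1)] RadD(3)[OF s(2)]
  let ?SA = "FO (NDom s) A" and ?SA' = "FO (NDom s') A"
  have SA: "?SA \<in> Obj C" "?SA' \<in> Obj C"
    using ss A by auto
  obtain v where v: "v \<in> Arr C" "Dom C v = ?SA" "Cod C v = ?SA'"
    "NComp s' A \<cdot>\<^bsub>C\<^esub> v = NComp s A"
    using factors_Fun_D[OF s(3) A ss(1,2)] A ss unfolding factors_def by auto
  obtain u where u: "u \<in> Arr C" "Dom C u = FO (NDom t) ?SA" "Cod C u = FO (NDom t') ?SA"
    "NComp t' ?SA \<cdot>\<^bsub>C\<^esub> u = NComp t ?SA"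
    using factors_Fun_D[OF t(3) SA(1) tt(1,2)] SA tt unfolding factors_def by auto
  \<comment> \<open>The path from TS to T'S by u, then to T'S' by T' applied to v. Naturality of t'
    at v moves v past t', after which u and v are absorbed by their defining equations.\<close>
  let ?w = "FA (NDom t') v \<cdot>\<^bsub>C\<^esub> u"
  have w: "?w \<in> Arr C" "Dom C ?w = FO (NDom t) ?SA" "Cod C ?w = FO (NDom t') ?SA'"
    using u v tt by auto
  have "NComp t' ?SA' \<cdot>\<^bsub>C\<^esub> FA (NDom t') v = v \<cdot>\<^bsub>C\<^esub> NComp t' ?SA"
    using naturality[OF tt(2) v(1)] v tt by simp
  then have "NComp t' ?SA' \<cdot>\<^bsub>C\<^esub> ?w = v \<cdot>\<^bsub>C\<^esub> (NComp t' ?SA \<cdot>\<^bsub>C\<^esub> u)"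
    by (rule C.comp_eq_extend) (use u v tt SA in auto)
  then have "NComp s' A \<cdot>\<^bsub>C\<^esub> (NComp t' ?SA' \<cdot>\<^bsub>C\<^esub> ?w) = NComp s' A \<cdot>\<^bsub>C\<^esub> (v \<cdot>\<^bsub>C\<^esub> NComp t ?SA)"
    using u by simp
  also have "\<dots> = (NComp s' A \<cdot>\<^bsub>C\<^esub> v) \<cdot>\<^bsub>C\<^esub> NComp t ?SA"
    by (rule C.assoc[symmetric]) (use u v tt ss SA A in auto)
  also have "\<dots> = NComp s A \<cdot>\<^bsub>C\<^esub> NComp t ?SA"
    using v by simp
  finally have "NComp (prod_rep C t' s') A \<cdot>\<^bsub>C\<^esub> ?w = NComp (prod_rep C t s) A"
    using w tt ss SA A by (simp add: prod_rep_def)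
  then show "factors C (NComp (prod_rep C t s) A) (NComp (prod_rep C t' s') A)"
    unfolding factors_def using w A SA tt ss by (intro bexI[of _ ?w]) (auto simp: prod_rep_def)
qed

lemma pr_prod_class:
  assumes t: "t \<in> Rad" and s: "s \<in> Rad"
  shows "pr_prod C (pr_class C t) (pr_class C s) = pr_class C (prod_rep C t s)"
proof -
  have "pr_class C (prod_rep C t' s') = pr_class C (prod_rep C t s)"
    if "t' \<in> pr_class C t" "s' \<in> pr_class C s" for t' s'
    using that unfolding mem_pr_class[OF t] mem_pr_class[OF s]
    by (intro pr_class_eq prod_rep_Rad prod_rep_factors t s) auto
  then show ?thesis
    using pr_class_self[OF t] pr_class_self[OF s] unfolding pr_prod_def prod_rep_def by blast
qed

section \<open>The duality on classes\<close>

lemma factors_op_nattrans: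
  assumes "is_nattrans C C m" "is_nattrans C C n"
  shows "factors (Fun (op_cat C) (op_cat C)) (op_nattrans m) (op_nattrans n) \<longleftrightarrow>
    factors (op_cat (Fun C C)) m n"
  using cat_iso.factors_iff[OF cat_iso_op_nattrans, of m n] assms by simp

lemma ex_cokernel_Rad:
  assumes "t \<in> Rad"
  obtains t' where "is_cokernel (Fun C C) t' t"
  using ex_cokernel_Fun RadD(2)[OF assms] by blast

lemma cokernel_Rad_op:
  assumes "t \<in> Rad" "is_cokernel (Fun C C) t' t"
  shows "op_nattrans t' \<in> monos_into (Fun (op_cat C) (op_cat C)) (id_funct (op_cat C))"
proof -
  interpret op: preradicals "op_cat C"
    by (rule preradicals_op)
  note d = is_cokernelD[OF assms(2)]
  have "is_kernel (Fun (op_cat C) (op_cat C)) (op_nattrans t') (op_nattrans t)"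
    using is_cokernel_Fun_iff[OF d(1,2)] assms(2) by blast
  then show ?thesis
    using op.F.is_kernel_mono d RadD(3)[OF assms(1)] by (simp add: monos_into_def)
qed

text \<open>A mono is the kernel of its cokernel, and over the opposite category this says that t is
  recovered as a cokernel of the dual. It is the reason why \<Delta> is an involution.\<close>

lemma cokernel_op_nattrans:
  assumes "t \<in> Rad" "is_cokernel (Fun C C) t' t"
  shows "is_cokernel (Fun (op_cat C) (op_cat C)) (op_nattrans t) (op_nattrans t')"
proof -
  interpret op: preradicals "op_cat C"
    by (rule preradicals_op)
  note d = is_cokernelD[OF assms(2)]
  have "is_kernel (Fun C C) t t'"
    using F.mono_is_kernel[OF RadD(1)[OF assms(1)] assms(2)] .
  then show ?thesis
    using op.is_cokernel_Fun_iff[of "op_nattrans t" "op_nattrans t'"] d by simp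
qed

lemma cokernels_factor_op:
  assumes "is_cokernel (Fun C C) s' s" "is_cokernel (Fun C C) t' t" "factors (Fun C C) s t"
  shows "factors (Fun (op_cat C) (op_cat C)) (op_nattrans t') (op_nattrans s')"
  using F.cokernels_factor[OF assms] is_cokernelD(1)[OF assms(1)] is_cokernelD(1)[OF assms(2)]
  by (simp add: factors_op_nattrans)

text \<open>Equivalent representatives have cokernels that factor through each other in the reverse
  direction, so the union over all choices collapses to one class.\<close>

lemma pr_dual_class:
  assumes t: "t \<in> Rad" "is_cokernel (Fun C C) t' t"
  shows "pr_dual C (pr_class C t) = pr_class (op_cat C) (op_nattrans t')"
proof -
  interpret op: preradicals "op_cat C"
    by (rule preradicals_op)
  have "pr_class (op_cat C) (op_nattrans n') = pr_class (op_cat C) (op_nattrans t')"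
    if n: "n \<in> pr_class C t" "is_cokernel (Fun C C) n' n" for n n'
  proof -
    have nt: "n \<in> Rad" "factors (Fun C C) t n" "factors (Fun C C) n t"
      using n(1) by (auto simp: mem_pr_class[OF t(1)])
    show ?thesis
      by (rule op.pr_class_eq[OF cokernel_Rad_op[OF nt(1) n(2)] cokernel_Rad_op[OF t]
            cokernels_factor_op[OF t(2) n(2) nt(2)] cokernels_factor_op[OF n(2) t(2) nt(3)]])
  qed
  then show ?thesis
    using pr_class_self[OF t(1)] t(2) unfolding pr_dual_def by blast
qed

lemma pr_dual_Pr:
  assumes "X \<in> Pr C"
  shows "pr_dual C X \<in> Pr (op_cat C)"
proof -
  interpret op: preradicals "op_cat C"
    by (rule preradicals_op)
  obtain t where t: "t \<in> Rad" "X = pr_class C t"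
    using assms by (auto simp: Pr_iff)
  obtain t' where t': "is_cokernel (Fun C C) t' t"
    using ex_cokernel_Rad[OF t(1)] .
  show ?thesis
    unfolding op.Pr_iff t(2) pr_dual_class[OF t(1) t'] using cokernel_Rad_op[OF t(1) t'] by blast
qed

lemma pr_dual_pr_dual:
  assumes "X \<in> Pr C"
  shows "pr_dual (op_cat C) (pr_dual C X) = X"
proof -
  interpret op: preradicals "op_cat C"
    by (rule preradicals_op)
  obtain t where t: "t \<in> Rad" "X = pr_class C t"
    using assms by (auto simp: Pr_iff)
  obtain t' where t': "is_cokernel (Fun C C) t' t"
    using ex_cokernel_Rad[OF t(1)] .
  show ?thesis
    using op.pr_dual_class[OF cokernel_Rad_op[OF t(1) t'] cokernel_op_nattrans[OF t(1) t']]
    by (simp add: t(2) pr_dual_class[OF t(1) t'])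
qed

section \<open>Coproducts and their duals\<close>

lemma is_nattrans_coprod_epi:
  assumes "s \<in> Rad" "is_cokernel (Fun C C) s' s" "t \<in> Rad" "is_cokernel (Fun C C) t' t"
  shows "is_nattrans C C (whisker C t' (NCod s') \<cdot>\<^bsub>Fun C C\<^esub> s')"
  using is_cokernelD[OF assms(2)] is_cokernelD[OF assms(4)] RadD(3)[OF assms(3)]
  by (intro is_nattrans_comp) auto

text \<open>Monotonicity of the coproduct in both arguments, without chasing pullbacks. Passing to
  cokernels reverses the order, the product over the opposite category preserves it, and taking
  kernels reverses it again.\<close>

lemma kernels_factor_coprod:
  assumes s: "s \<in> Rad" "is_cokernel (Fun C C) s' s" and t: "t \<in> Rad" "is_cokernel (Fun C C) t' t"
    and n: "n \<in> Rad" "is_cokernel (Fun C C) n' n" and m: "m \<in> Rad" "is_cokernel (Fun C C) m' m"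
    and sn: "factors (Fun C C) s n" and tm: "factors (Fun C C) t m"
    and q: "is_kernel (Fun C C) q (whisker C t' (NCod s') \<cdot>\<^bsub>Fun C C\<^esub> s')"
    and r: "is_kernel (Fun C C) r (whisker C m' (NCod n') \<cdot>\<^bsub>Fun C C\<^esub> n')"
  shows "factors (Fun C C) q r"
proof -
  interpret op: preradicals "op_cat C"
    by (rule preradicals_op)
  have "factors (Fun (op_cat C) (op_cat C)) (prod_rep (op_cat C) (op_nattrans m') (op_nattrans n'))
    (prod_rep (op_cat C) (op_nattrans t') (op_nattrans s'))"
    by (rule op.prod_rep_factors[OF cokernel_Rad_op[OF m] cokernel_Rad_op[OF t]
          cokernels_factor_op[OF t(2) m(2) tm] cokernel_Rad_op[OF n] cokernel_Rad_op[OF s]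
          cokernels_factor_op[OF s(2) n(2) sn]])
  then have "factors (op_cat (Fun C C)) (whisker C m' (NCod n') \<cdot>\<^bsub>Fun C C\<^esub> n')
    (whisker C t' (NCod s') \<cdot>\<^bsub>Fun C C\<^esub> s')"
    using is_nattrans_coprod_epi[OF s t] is_nattrans_coprod_epi[OF n m]
    by (simp add: op_nattrans_prod_rep factors_op_nattrans)
  then show ?thesis
    by (rule F.kernels_factor[OF q r])
qed

lemma pr_coprod_class:
  assumes s: "s \<in> Rad" "is_cokernel (Fun C C) s' s" and t: "t \<in> Rad" "is_cokernel (Fun C C) t' t"
    and q: "is_kernel (Fun C C) q (whisker C t' (NCod s') \<cdot>\<^bsub>Fun C C\<^esub> s')"
  shows "q \<in> Rad" "pr_coprod C (pr_class C s) (pr_class C t) = pr_class C q"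
proof -
  have RadK: "r \<in> Rad" if "n \<in> Rad" "is_cokernel (Fun C C) n' n"
    "is_kernel (Fun C C) r (whisker C m' (NCod n') \<cdot>\<^bsub>Fun C C\<^esub> n')" for r n n' m'
    using F.is_kernel_mono[OF that(3)] F.is_kernelD[OF that(3)] is_cokernelD[OF that(2)] RadD(3)[OF that(1)]
    by (simp add: Rad_iff)
  show qR: "q \<in> Rad"
    using RadK[OF s q] .
  \<comment> \<open>Whiskering keeps m the kernel of m', so each choice of pullback is the same as a
    choice of kernel of the composite epi.\<close>
  have pb: "(\<exists>p. is_pullback (Fun C C) (whisker C m (NCod n')) n' p r) \<longleftrightarrow>
      is_kernel (Fun C C) r (whisker C m' (NCod n') \<cdot>\<^bsub>Fun C C\<^esub> n')"
    if "is_cokernel (Fun C C) n' n" "m \<in> Rad" "is_cokernel (Fun C C) m' m" for n n' m m' r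
  proof (rule F.pullback_of_kernel_iff)
    note n' = is_cokernelD[OF that(1)] and m' = is_cokernelD[OF that(3)]
    show "is_kernel (Fun C C) (whisker C m (NCod n')) (whisker C m' (NCod n'))"
      using n' F.mono_is_kernel[OF RadD(1)[OF that(2)] that(3)] by (intro is_kernel_whisker) auto
    show "n' \<in> Arr (Fun C C)" "Cod (Fun C C) n' = Dom (Fun C C) (whisker C m' (NCod n'))"
      using n' m' RadD(3)[OF that(2)] by auto
  qed
  have eq: "pr_class C r = pr_class C q"
    if n: "n \<in> pr_class C s" "is_cokernel (Fun C C) n' n" and m: "m \<in> pr_class C t"
      and r: "is_pullback (Fun C C) (whisker C m (NCod n')) n' p r" for n n' m p r
  proof -
    have nR: "n \<in> Rad" "factors (Fun C C) s n" "factors (Fun C C) n s"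
      and mR: "m \<in> Rad" "factors (Fun C C) t m" "factors (Fun C C) m t"
      using n m mem_pr_class s t by auto
    obtain m' where m': "is_cokernel (Fun C C) m' m"
      using ex_cokernel_Rad[OF mR(1)] .
    have rk: "is_kernel (Fun C C) r (whisker C m' (NCod n') \<cdot>\<^bsub>Fun C C\<^esub> n')"
      using pb[OF n(2) mR(1) m'] r by blast
    show ?thesis
      by (rule pr_class_eq[OF RadK[OF nR(1) n(2) rk] qR
            kernels_factor_coprod[OF nR(1) n(2) mR(1) m' s t nR(3) mR(3) rk q]
            kernels_factor_coprod[OF s t nR(1) n(2) mR(1) m' nR(2) mR(2) q rk]])
  qed
  \<comment> \<open>The union has at least one member; without it, equality of all members would not
    determine the union.\<close>
  obtain p where "is_pullback (Fun C C) (whisker C t (NCod s')) s' p q"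
    using pb[OF s(2) t] q by blast
  then show "pr_coprod C (pr_class C s) (pr_class C t) = pr_class C q"
    using eq pr_class_self[OF s(1)] pr_class_self[OF t(1)] s(2) unfolding pr_coprod_def by blast
qed

text \<open>The coproduct is represented by a kernel q of the composite epi; an epi is the cokernel
  of its kernel, so \<Delta> returns that epi. Membership in \<open>Pr C\<close> is recorded because
  the involution law is stated for preradicals.\<close>

lemma pr_dual_pr_coprod:
  assumes "X \<in> Pr C" "Y \<in> Pr C"
  shows "pr_coprod C X Y \<in> Pr C"
    "pr_dual C (pr_coprod C X Y) = pr_prod (op_cat C) (pr_dual C Y) (pr_dual C X)"
proof -
  interpret op: preradicals "op_cat C"
    by (rule preradicals_op)
  obtain s t where s: "s \<in> Rad" "X = pr_class C s" and t: "t \<in> Rad" "Y = pr_class C t"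
    using assms by (auto simp: Pr_iff)
  obtain s' t' where s': "is_cokernel (Fun C C) s' s" and t': "is_cokernel (Fun C C) t' t"
    using ex_cokernel_Rad[OF s(1)] ex_cokernel_Rad[OF t(1)] by metis
  let ?e = "whisker C t' (NCod s') \<cdot>\<^bsub>Fun C C\<^esub> s'"
  have e: "is_nattrans C C ?e"
    using is_nattrans_coprod_epi[OF s(1) s' t(1) t'] .
  then obtain q where q: "is_kernel (Fun C C) q ?e"
    using ex_kernel_Fun by blast
  note cop = pr_coprod_class[OF s(1) s' t(1) t' q]
  show "pr_coprod C X Y \<in> Pr C"
    using cop s t by (auto simp: Pr_iff)
  \<comment> \<open>Read over the opposite category, \<open>?e\<close> represents a product of two
    preradicals and is therefore mono there.\<close>
  have "is_epi (Fun C C) ?e"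
    using op.RadD(1)[OF op.prod_rep_Rad[OF cokernel_Rad_op[OF t(1) t'] cokernel_Rad_op[OF s(1) s']]]
    unfolding op_nattrans_prod_rep is_epi_Fun_iff[OF e] .
  then have "is_cokernel (Fun C C) ?e q"
    using q by (rule F.epi_is_cokernel)
  then have "pr_dual C (pr_coprod C X Y) = pr_class (op_cat C) (op_nattrans ?e)"
    using pr_dual_class[OF cop(1)] cop(2) s t by simp
  also have "\<dots> = pr_prod (op_cat C) (pr_dual C Y) (pr_dual C X)"
    using op.pr_prod_class[OF cokernel_Rad_op[OF t(1) t'] cokernel_Rad_op[OF s(1) s']]
      pr_dual_class[OF s(1) s'] pr_dual_class[OF t(1) t'] s t
    by (simp add: op_nattrans_prod_rep)
  finally show "pr_dual C (pr_coprod C X Y) = pr_prod (op_cat C) (pr_dual C Y) (pr_dual C X)" .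
qed

end

theorem proposition3p10:
  fixes C :: "('o, 'a) cat" and \<tau> \<sigma> :: "('o, 'a) prerad"
  assumes "abelian_category C"
    and "\<tau> \<in> Pr C" and "\<sigma> \<in> Pr C"
  shows "pr_dual C (pr_coprod C \<sigma> \<tau>) = pr_prod (op_cat C) (pr_dual C \<tau>) (pr_dual C \<sigma>) \<and>
    pr_dual C (pr_prod C \<tau> \<sigma>) = pr_coprod (op_cat C) (pr_dual C \<sigma>) (pr_dual C \<tau>)"
proof
  interpret preradicals C
    by (intro preradicals.intro functor_category.intro assms(1) abelian_category.axioms(1)[OF assms(1)])
  interpret op: preradicals "op_cat C"
    by (rule preradicals_op)
  show "pr_dual C (pr_coprod C \<sigma> \<tau>) = pr_prod (op_cat C) (pr_dual C \<tau>) (pr_dual C \<sigma>)"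
    using assms by (intro pr_dual_pr_coprod)
  have d: "pr_dual C \<tau> \<in> Pr (op_cat C)" "pr_dual C \<sigma> \<in> Pr (op_cat C)"
    using assms by (auto intro: pr_dual_Pr)
  \<comment> \<open>The first identity for the opposite category, applied to the duals of \<sigma>
    and \<tau>; the double duals on its right-hand side cancel.\<close>
  have "pr_dual (op_cat C) (pr_coprod (op_cat C) (pr_dual C \<sigma>) (pr_dual C \<tau>)) = pr_prod C \<tau> \<sigma>"
    using op.pr_dual_pr_coprod(2)[OF d(2,1)] pr_dual_pr_dual assms by simp
  \<comment> \<open>Applying \<Delta> once more removes the outer dual, since the coproduct over
    \<open>op_cat C\<close> is itself a preradical class.\<close>
  then show "pr_dual C (pr_prod C \<tau> \<sigma>) = pr_coprod (op_cat C) (pr_dual C \<sigma>) (pr_dual C \<tau>)"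
    using op.pr_dual_pr_dual[OF op.pr_dual_pr_coprod(1)[OF d(2,1)]] by simp
qed

end
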